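(* Let $\mathcal{H}$ be a graded connected Hopf algebra over $\mathbb{R}$ (with finite-dimensional graded pieces) equipped with an inner product $\langle\,,\rangle$ adjoining product and coproduct, that is, $\langle wz,x\rangle=\langle w\otimes z,\Delta(x)\rangle$ for all $w,z,x\in\mathcal{H}$, where $\langle w\otimes z,u\otimes v\rangle=\langle w,u\rangle\langle z,v\rangle$. Let $\mathcal{B}$ be a state space basis of $\mathcal{H}$ which is orthogonal under this inner product, with $\mathcal{B}_1=\{\bullet\}$ (or: $\mathcal{H}$ is multigraded and $\mathcal{B}_{(1,0,\dots,0)}=\{\bullet_1\}$, $\mathcal{B}_{(0,1,0,\dots,0)}=\{\bullet_2\}$ and so on). Assume in addition that, for all $y\in\mathcal{B}$ with $\deg(y)>1$, there are some $w,z\in\mathcal{B}$ with $\deg(w),\deg(z)>0$ such that $\xi^y_{w,z}\ne0$. Then the $a$th Hopf-power Markov chain on $\mathcal{B}_n$ (or $\mathcal{B}_\nu$) is reversible.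
   Context: A graded connected Hopf algebra over $\mathbb{R}$ is $\mathcal{H}=\bigoplus_{n\ge0}\mathcal{H}_n$ with $\mathcal{H}_0=\mathbb{R}\cdot1$, an associative unital product $\mathcal{H}_i\otimes\mathcal{H}_j\to\mathcal{H}_{i+j}$ and a coassociative coproduct $\Delta:\mathcal{H}_n\to\bigoplus_{j=0}^n\mathcal{H}_j\otimes\mathcal{H}_{n-j}$ with $\Delta(x)-1\otimes x-x\otimes1\in\bigoplus_{j=1}^{n-1}\mathcal{H}_j\otimes\mathcal{H}_{n-j}$ for $x\in\mathcal{H}_n$ ($n\ge1$), $\Delta(1)=1\otimes1$, and $\Delta(wz)=\Delta(w)\Delta(z)$. $\Psi^a:=m^{[a]}\Delta^{[a]}$ is the $a$-fold coproduct followed by the $a$-fold product; here $a\ge2$. For a basis $\mathcal{B}=\amalg_n\mathcal{B}_n$ ($\mathcal{B}_n$ a basis of $\mathcal{H}_n$, $\mathcal{B}_0=\{1\}$), structure constants are defined by $z_1\cdots z_a=\sum_{y\in\mathcal{B}}\xi^y_{z_1,\dots,z_a}y$ and $\Delta^{[a]}(x)=\sum_{z_1,\dots,z_a\in\mathcal{B}}\eta_x^{z_1,\dots,z_a}z_1\otimes\cdots\otimes z_a$. $\mathcal{B}$ is a state space basis if all $\xi^y_{w,z}\ge0$, all $\eta_x^{w,z}\ge0$, and no $x\in\mathcal{B}$ with $\deg x>1$ satisfies $\Delta(x)=1\otimes x+x\otimes1$. The rescaling function is $\eta(x):=\sum_{c_1,\dots,c_n\in\mathcal{B}_1}\eta_x^{c_1,\dots,c_n}$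 for $x\in\mathcal{B}_n$ (strictly positive on a state space basis). The $a$th Hopf-power Markov chain on $\mathcal{B}_n$ has transition matrix $\check K_{a,n}$ defined by $a^{-n}\Psi^a(x)=\sum_{y\in\mathcal{B}_n}\frac{\eta(x)}{\eta(y)}\check K_{a,n}(x,y)\,y$ for $x\in\mathcal{B}_n$. Multigraded means that $\mathcal{H}_n=\bigoplus_{|\nu|=n}\mathcal{H}_\nu$ over tuples $\nu$ of non-negative integers, product and coproduct respect the multidegree, and $\mathcal{B}=\amalg_\nu\mathcal{B}_\nu$ with $\mathcal{B}_\nu$ a basis of $\mathcal{H}_\nu$; the chain on $\mathcal{B}_\nu$ is the restriction of the chain on $\mathcal{B}_{|\nu|}$. A Markov chain with transition matrix $K$ is reversible if it has a unique stationary distribution $\pi$, with $\pi(x)>0$ for all states $x$, and it satisfies the detailed balance equation $\pi(x)K(x,y)=\pi(y)K(y,x)$ for all $x,y$ (equivalently it equals its time-reversal). *)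

theory Defs
  imports "HOL-Analysis.Analysis" "HOL-Analysis.Finite_Function_Topology"
begin

section \<open>Tensor powers of a real vector space\<close>

text \<open>
  \<open>'v tensor\<close> is the direct sum of all tensor powers of \<open>'v\<close>: the free vector space on the words
  over \<open>'v\<close> modulo multilinearity in each letter.  The word \<open>[v1, ..., vk]\<close> represents the pure tensor
  of \<open>v1, ..., vk\<close> in the \<open>k\<close>-th tensor power.
\<close>

inductive_set multilinear_relations :: "('v::real_vector list \<Rightarrow>\<^sub>0 real) set" where
  "Poly_Mapping.single (us @ (x + y) # vs) 1 - Poly_Mapping.single (us @ x # vs) 1
     - Poly_Mapping.single (us @ y # vs) 1 \<in> multilinear_relations"
| "Poly_Mapping.single (us @ (c *\<^sub>R x) # vs) 1 - c *\<^sub>R Poly_Mapping.single (us @ x # vs) 1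
     \<in> multilinear_relations"

quotient_type (overloaded) 'v tensor = "'v::real_vector list \<Rightarrow>\<^sub>0 real"
  / "\<lambda>p q. p - q \<in> span multilinear_relations"
proof (rule equivpI)
  show "reflp (\<lambda>p q. p - q \<in> span (multilinear_relations :: ('v list \<Rightarrow>\<^sub>0 real) set))"
    by (auto intro!: reflpI simp: span_zero)
  show "symp (\<lambda>p q. p - q \<in> span (multilinear_relations :: ('v list \<Rightarrow>\<^sub>0 real) set))"
    by (metis (mono_tags, lifting) minus_diff_eq span_neg sympI)
  show "transp (\<lambda>p q. p - q \<in> span (multilinear_relations :: ('v list \<Rightarrow>\<^sub>0 real) set))"
  proof (rule transpI)
    fix p q r :: "'v list \<Rightarrow>\<^sub>0 real"
    assume "p - q \<in> span multilinear_relations" "q - r \<in> span multilinear_relations"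
    then have "(p - q) + (q - r) \<in> span multilinear_relations" by (rule span_add)
    then show "p - r \<in> span multilinear_relations" by simp
  qed
qed

instantiation tensor :: (real_vector) real_vector
begin

lift_definition zero_tensor :: "'a tensor" is 0 .

lift_definition plus_tensor :: "'a tensor \<Rightarrow> 'a tensor \<Rightarrow> 'a tensor" is "(+)"
  by (metis (no_types, lifting) add_diff_add span_add)

lift_definition uminus_tensor :: "'a tensor \<Rightarrow> 'a tensor" is uminus
  by (metis (no_types, lifting) minus_diff_minus span_neg)

lift_definition minus_tensor :: "'a tensor \<Rightarrow> 'a tensor \<Rightarrow> 'a tensor" is "(-)"
proof -
  fix p q r s :: "'a list \<Rightarrow>\<^sub>0 real"
  assume "p - q \<in> span multilinear_relations" "r - s \<in> span multilinear_relations"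
  then have "(p - q) - (r - s) \<in> span multilinear_relations" by (rule span_diff)
  moreover have "(p - q) - (r - s) = (p - r) - (q - s)" by simp
  ultimately show "(p - r) - (q - s) \<in> span multilinear_relations" by simp
qed

lift_definition scaleR_tensor :: "real \<Rightarrow> 'a tensor \<Rightarrow> 'a tensor" is scaleR
  by (metis (no_types, lifting) scaleR_diff_right span_scale)

instance
  by standard (transfer; simp add: span_zero algebra_simps)+

end

lift_definition tensor :: "'v::real_vector list \<Rightarrow> 'v tensor"
  is "\<lambda>xs. Poly_Mapping.single xs 1" .

abbreviation tensor2 :: "'v::real_vector \<Rightarrow> 'v \<Rightarrow> 'v tensor" (infixl "\<otimes>" 70)
  where "u \<otimes> v \<equiv> tensor [u, v]"

definition tensor_spaces :: "'v::real_vector set \<Rightarrow> 'v set \<Rightarrow> 'v tensor set"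
  where "tensor_spaces V W = span {v \<otimes> w | v w. v \<in> V \<and> w \<in> W}"

definition multilinear :: "('v::real_vector list \<Rightarrow> 'w::real_vector) \<Rightarrow> bool"
  where "multilinear F \<longleftrightarrow> (\<forall>us vs. linear (\<lambda>x. F (us @ x # vs)))"

text \<open>The linear extension of a map that is multilinear on words of each length.\<close>

definition tensor_lift :: "('v::real_vector list \<Rightarrow> 'w::real_vector) \<Rightarrow> 'v tensor \<Rightarrow> 'w"
  where "tensor_lift F = (THE L. linear L \<and> (\<forall>xs. L (tensor xs) = F xs))"

text \<open>
  The product of two tensors of the same length, the inner product induced on a tensor power, and
  the map \<open>id \<otimes> ... \<otimes> f \<otimes> ... \<otimes> id\<close> with \<open>f\<close> acting on the factor with index \<open>i\<close> (counted from 0),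
  where \<open>f\<close> may take values in any tensor power.
\<close>

definition tensor_mult :: "'v::real_algebra_1 tensor \<Rightarrow> 'v tensor \<Rightarrow> 'v tensor"
  where "tensor_mult s t =
    tensor_lift (\<lambda>xs. tensor_lift (\<lambda>ys.
      if length xs = length ys then tensor (map2 (*) xs ys) else 0) t) s"

definition tensor_inner :: "'v::real_inner tensor \<Rightarrow> 'v tensor \<Rightarrow> real"
  where "tensor_inner s t =
    tensor_lift (\<lambda>xs. tensor_lift (\<lambda>ys.
      if length xs = length ys then prod_list (map2 (\<bullet>) xs ys) else 0) t) s"

definition tensor_apply :: "nat \<Rightarrow> ('v::real_vector \<Rightarrow> 'v tensor) \<Rightarrow> 'v tensor \<Rightarrow> 'v tensor"
  where "tensor_apply i f =
    tensor_lift (\<lambda>xs. if i < length xs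
      then tensor_lift (\<lambda>ys. tensor (take i xs @ ys @ drop (Suc i) xs)) (f (xs ! i)) else 0)"


section \<open>Graded connected Hopf algebras\<close>

definition direct_sum :: "'i set \<Rightarrow> ('i \<Rightarrow> 'v::real_vector set) \<Rightarrow> 'v set \<Rightarrow> bool"
  where "direct_sum I V W \<longleftrightarrow>
    (\<forall>i\<in>I. subspace (V i)) \<and>
    W = span (\<Union>i\<in>I. V i) \<and>
    (\<forall>F f. finite F \<and> F \<subseteq> I \<and> (\<forall>i\<in>F. f i \<in> V i) \<and> sum f F = 0 \<longrightarrow> (\<forall>i\<in>F. f i = 0))"

text \<open>The counit and the antipode exist automatically and are not part of the data.\<close>

locale graded_connected_hopf_algebra =
  fixes H :: "nat \<Rightarrow> 'h::real_algebra_1 set"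
    and \<Delta> :: "'h \<Rightarrow> 'h tensor"
  assumes grading: "direct_sum UNIV H UNIV"
    and connected: "H 0 = range (\<lambda>r. r *\<^sub>R 1)"
    and mult_grading: "x \<in> H i \<Longrightarrow> y \<in> H j \<Longrightarrow> x * y \<in> H (i + j)"
    and linear_coproduct: "linear \<Delta>"
    and coproduct_grading:
      "x \<in> H n \<Longrightarrow> \<Delta> x \<in> span (\<Union>j\<in>{0..n}. tensor_spaces (H j) (H (n - j)))"
    and coassociative: "tensor_apply 0 \<Delta> (\<Delta> x) = tensor_apply 1 \<Delta> (\<Delta> x)"
    and coproduct_reduced:
      "n \<ge> 1 \<Longrightarrow> x \<in> H n \<Longrightarrow>
        \<Delta> x - 1 \<otimes> x - x \<otimes> 1 \<in> span (\<Union>j\<in>{1..<n}. tensor_spaces (H j) (H (n - j)))"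
    and coproduct_one: "\<Delta> 1 = 1 \<otimes> 1"
    and coproduct_mult: "\<Delta> (w * z) = tensor_mult (\<Delta> w) (\<Delta> z)"

text \<open>The coefficient of the unit in the component of degree 0.\<close>

definition counit :: "(nat \<Rightarrow> 'h::real_algebra_1 set) \<Rightarrow> 'h \<Rightarrow> real"
  where "counit H x = (THE r. x - r *\<^sub>R 1 \<in> span (\<Union>n\<in>{1..}. H n))"

fun iterated_coproduct ::
    "(nat \<Rightarrow> 'h::real_algebra_1 set) \<Rightarrow> ('h \<Rightarrow> 'h tensor) \<Rightarrow> nat \<Rightarrow> 'h \<Rightarrow> 'h tensor"
  where
    "iterated_coproduct H \<Delta> 0 x = counit H x *\<^sub>R tensor []"
  | "iterated_coproduct H \<Delta> (Suc 0) x = tensor [x]"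
  | "iterated_coproduct H \<Delta> (Suc (Suc k)) x =
       tensor_apply k \<Delta> (iterated_coproduct H \<Delta> (Suc k) x)"

definition hopf_power ::
    "(nat \<Rightarrow> 'h::real_algebra_1 set) \<Rightarrow> ('h \<Rightarrow> 'h tensor) \<Rightarrow> nat \<Rightarrow> 'h \<Rightarrow> 'h"
  where "hopf_power H \<Delta> a x = tensor_lift prod_list (iterated_coproduct H \<Delta> a x)"


section \<open>State space bases\<close>

definition graded_basis :: "(nat \<Rightarrow> 'h::real_algebra_1 set) \<Rightarrow> (nat \<Rightarrow> 'h set) \<Rightarrow> bool"
  where "graded_basis H B \<longleftrightarrow> (\<forall>n. independent (B n) \<and> span (B n) = H n) \<and> B 0 = {1}"

definition product_coeff :: "(nat \<Rightarrow> 'h::real_algebra_1 set) \<Rightarrow> 'h list \<Rightarrow> 'h \<Rightarrow> real"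
  where "product_coeff B zs y = representation (\<Union>n. B n) (prod_list zs) y"

definition coproduct_coeff ::
    "(nat \<Rightarrow> 'h::real_algebra_1 set) \<Rightarrow> ('h \<Rightarrow> 'h tensor) \<Rightarrow> (nat \<Rightarrow> 'h set) \<Rightarrow> 'h \<Rightarrow> 'h list \<Rightarrow> real"
  where "coproduct_coeff H \<Delta> B x zs =
    representation (tensor ` lists (\<Union>n. B n)) (iterated_coproduct H \<Delta> (length zs) x) (tensor zs)"

definition state_space_basis ::
    "(nat \<Rightarrow> 'h::real_algebra_1 set) \<Rightarrow> ('h \<Rightarrow> 'h tensor) \<Rightarrow> (nat \<Rightarrow> 'h set) \<Rightarrow> bool"
  where "state_space_basis H \<Delta> B \<longleftrightarrow>
    graded_basis H B \<and>
    (\<forall>w\<in>\<Union>n. B n. \<forall>z\<in>\<Union>n. B n. \<forall>y\<in>\<Union>n. B n. product_coeff B [w, z] y \<ge> 0) \<and>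
    (\<forall>w\<in>\<Union>n. B n. \<forall>z\<in>\<Union>n. B n. \<forall>x\<in>\<Union>n. B n. coproduct_coeff H \<Delta> B x [w, z] \<ge> 0) \<and>
    (\<forall>n>1. \<forall>x\<in>B n. \<Delta> x \<noteq> 1 \<otimes> x + x \<otimes> 1)"


section \<open>Hopf-power Markov chains\<close>

definition rescaling ::
    "(nat \<Rightarrow> 'h::real_algebra_1 set) \<Rightarrow> ('h \<Rightarrow> 'h tensor) \<Rightarrow> (nat \<Rightarrow> 'h set) \<Rightarrow> nat \<Rightarrow> 'h \<Rightarrow> real"
  where "rescaling H \<Delta> B n x =
    (\<Sum>cs\<in>{cs. set cs \<subseteq> B 1 \<and> length cs = n}. coproduct_coeff H \<Delta> B x cs)"

text \<open>
  The defining equation \<open>a\<^sup>-\<^sup>n \<Psi>\<^sup>a(x) = \<Sum>y\<in>B n. \<eta>(x) / \<eta>(y) * K(x, y) y\<close>, solved for \<open>K(x, y)\<close>;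
  see \<open>hopf_power_matrix_eq\<close> below.
\<close>

definition hopf_power_matrix ::
    "(nat \<Rightarrow> 'h::real_algebra_1 set) \<Rightarrow> ('h \<Rightarrow> 'h tensor) \<Rightarrow> (nat \<Rightarrow> 'h set) \<Rightarrow>
      nat \<Rightarrow> nat \<Rightarrow> 'h \<Rightarrow> 'h \<Rightarrow> real"
  where "hopf_power_matrix H \<Delta> B a n x y =
    rescaling H \<Delta> B n y / rescaling H \<Delta> B n x *
    representation (B n) ((1 / real a ^ n) *\<^sub>R hopf_power H \<Delta> a x) y"


section \<open>Multigradings\<close>

text \<open>Multidegrees are the elements of \<open>nat ^ 'i\<close>; the \<open>i\<close>-th unit tuple is \<open>axis i 1\<close>.\<close>

definition total_degree :: "nat ^ 'i \<Rightarrow> nat"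
  where "total_degree \<nu> = (\<Sum>i\<in>UNIV. \<nu> $ i)"

definition multigrading ::
    "(nat \<Rightarrow> 'h::real_algebra_1 set) \<Rightarrow> ('h \<Rightarrow> 'h tensor) \<Rightarrow> (nat ^ 'i \<Rightarrow> 'h set) \<Rightarrow> bool"
  where "multigrading H \<Delta> M \<longleftrightarrow>
    (\<forall>n. direct_sum {\<nu>. total_degree \<nu> = n} M (H n)) \<and>
    (\<forall>\<mu> \<nu>. \<forall>x\<in>M \<mu>. \<forall>y\<in>M \<nu>. x * y \<in> M (\<mu> + \<nu>)) \<and>
    (\<forall>\<nu>. \<forall>x\<in>M \<nu>. \<Delta> x \<in> span (\<Union>(\<mu>, \<mu>')\<in>{(\<mu>, \<mu>'). \<mu> + \<mu>' = \<nu>}. tensor_spaces (M \<mu>) (M \<mu>')))"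

definition multigraded_basis ::
    "(nat ^ 'i \<Rightarrow> 'h::real_algebra_1 set) \<Rightarrow> (nat \<Rightarrow> 'h set) \<Rightarrow> (nat ^ 'i \<Rightarrow> 'h set) \<Rightarrow> bool"
  where "multigraded_basis M B C \<longleftrightarrow>
    (\<forall>\<nu>. independent (C \<nu>) \<and> span (C \<nu>) = M \<nu>) \<and>
    (\<forall>n. B n = (\<Union>\<nu>\<in>{\<nu>. total_degree \<nu> = n}. C \<nu>))"


section \<open>Reversible Markov chains on a finite state space\<close>

definition transition_matrix :: "'s set \<Rightarrow> ('s \<Rightarrow> 's \<Rightarrow> real) \<Rightarrow> bool"
  where "transition_matrix S K \<longleftrightarrow>
    finite S \<and> (\<forall>x\<in>S. \<forall>y\<in>S. K x y \<ge> 0) \<and> (\<forall>x\<in>S. (\<Sum>y\<in>S. K x y) = 1)"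

definition stationary_distribution :: "'s set \<Rightarrow> ('s \<Rightarrow> 's \<Rightarrow> real) \<Rightarrow> ('s \<Rightarrow> real) \<Rightarrow> bool"
  where "stationary_distribution S K \<pi> \<longleftrightarrow>
    (\<forall>x\<in>S. \<pi> x \<ge> 0) \<and> (\<Sum>x\<in>S. \<pi> x) = 1 \<and> (\<forall>y\<in>S. (\<Sum>x\<in>S. \<pi> x * K x y) = \<pi> y)"

definition reversible_chain :: "'s set \<Rightarrow> ('s \<Rightarrow> 's \<Rightarrow> real) \<Rightarrow> bool"
  where "reversible_chain S K \<longleftrightarrow>
    transition_matrix S K \<and>
    (\<exists>\<pi>. stationary_distribution S K \<pi> \<and>
      (\<forall>\<pi>'. stationary_distribution S K \<pi>' \<longrightarrow> (\<forall>x\<in>S. \<pi>' x = \<pi> x)) \<and>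
      (\<forall>x\<in>S. \<pi> x > 0) \<and>
      (\<forall>x\<in>S. \<forall>y\<in>S. \<pi> x * K x y = \<pi> y * K y x))"


section \<open>Basic facts about tensors and the transition matrix\<close>

lemma multilinear_tensor: "multilinear (tensor :: 'v::real_vector list \<Rightarrow> 'v tensor)"
  unfolding multilinear_def
proof (intro allI linearI)
  fix us vs :: "'v list" and x y :: 'v and c :: real
  have "Poly_Mapping.single (us @ (x + y) # vs) (1::real) -
      (Poly_Mapping.single (us @ x # vs) 1 + Poly_Mapping.single (us @ y # vs) 1)
      \<in> span multilinear_relations"
    unfolding diff_diff_add[symmetric] by (rule span_base) (rule multilinear_relations.intros)
  then show "tensor (us @ (x + y) # vs) = tensor (us @ x # vs) + tensor (us @ y # vs)"
    unfolding tensor.abs_eq plus_tensor.abs_eq tensor.abs_eq_iff .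
  have "Poly_Mapping.single (us @ (c *\<^sub>R x) # vs) (1::real) -
      c *\<^sub>R Poly_Mapping.single (us @ x # vs) 1 \<in> span multilinear_relations"
    by (rule span_base) (rule multilinear_relations.intros)
  then show "tensor (us @ (c *\<^sub>R x) # vs) = c *\<^sub>R tensor (us @ x # vs)"
    unfolding tensor.abs_eq scaleR_tensor.abs_eq tensor.abs_eq_iff .
qed

lemma lookup_scaleR: "Poly_Mapping.lookup (c *\<^sub>R p) k = c *\<^sub>R Poly_Mapping.lookup p k"
  for p :: "'k \<Rightarrow>\<^sub>0 'v::real_vector"
proof -
  have "{k. c *\<^sub>R Poly_Mapping.lookup p k \<noteq> 0} \<subseteq> {k. Poly_Mapping.lookup p k \<noteq> 0}" by auto
  then have "finite {k. c *\<^sub>R Poly_Mapping.lookup p k \<noteq> 0}"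
    by (rule finite_subset) (rule finite_lookup)
  then show ?thesis by (simp add: scaleR_poly_mapping_def)
qed

lemma poly_mapping_expansion:
  fixes p :: "'k \<Rightarrow>\<^sub>0 real"
  shows "p = (\<Sum>k\<in>Poly_Mapping.keys p. Poly_Mapping.lookup p k *\<^sub>R Poly_Mapping.single k 1)"
proof (rule poly_mapping_eqI)
  fix k
  show "Poly_Mapping.lookup p k =
      Poly_Mapping.lookup (\<Sum>k\<in>Poly_Mapping.keys p. Poly_Mapping.lookup p k *\<^sub>R Poly_Mapping.single k 1) k"
    by (simp add: lookup_sum lookup_scaleR lookup_single when_def if_distrib in_keys_iff cong: if_cong)
qed

lemma ex_abs_tensor: "\<exists>p. t = abs_tensor p"
  by (induction t rule: tensor.abs_induct) blast

lemma linear_abs_tensor: "linear abs_tensor"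
  by (rule linearI) (simp_all add: plus_tensor.abs_eq scaleR_tensor.abs_eq)

lemma span_tensor: "span (range tensor) = (UNIV :: 'v::real_vector tensor set)"
proof (rule set_eqI, simp)
  fix t :: "'v tensor"
  obtain p where "t = abs_tensor p" using ex_abs_tensor[of t] by blast
  also have "abs_tensor p =
      abs_tensor (\<Sum>k\<in>Poly_Mapping.keys p. Poly_Mapping.lookup p k *\<^sub>R Poly_Mapping.single k 1)"
    by (rule arg_cong, rule poly_mapping_expansion)
  also have "\<dots> = (\<Sum>k\<in>Poly_Mapping.keys p. Poly_Mapping.lookup p k *\<^sub>R tensor k)"
    by (simp only: linear_sum[OF linear_abs_tensor] linear_scale[OF linear_abs_tensor] tensor.abs_eq)
  finally have "t = (\<Sum>k\<in>Poly_Mapping.keys p. Poly_Mapping.lookup p k *\<^sub>R tensor k)" .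
  then show "t \<in> span (range tensor)"
    by (simp add: span_sum span_scale span_base)
qed

lemma tensor_lift_unique:
  fixes L L' :: "'v::real_vector tensor \<Rightarrow> 'w::real_vector"
  assumes "linear L" "linear L'" "\<And>xs. L (tensor xs) = L' (tensor xs)"
  shows "L = L'"
proof
  fix t :: "'v tensor"
  have "t \<in> span (range tensor)" by (simp add: span_tensor)
  then show "L t = L' t" by (rule linear_eq_on[OF assms(1,2)]) (auto simp: assms(3))
qed

lemma ex_tensor_lift:
  fixes F :: "'v::real_vector list \<Rightarrow> 'w::real_vector"
  assumes F: "multilinear F"
  shows "\<exists>L. linear L \<and> (\<forall>xs. L (tensor xs) = F xs)"
proof -
  define G where "G p = (\<Sum>k\<in>Poly_Mapping.keys p. Poly_Mapping.lookup p k *\<^sub>R F k)" for p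
  have G: "G p = (\<Sum>k\<in>A. Poly_Mapping.lookup p k *\<^sub>R F k)"
    if "finite A" "Poly_Mapping.keys p \<subseteq> A" for p A
    unfolding G_def using that by (intro sum.mono_neutral_left) (auto simp: in_keys_iff)
  have linG: "linear G"
  proof (rule linearI)
    fix p q :: "'v list \<Rightarrow>\<^sub>0 real" and c :: real
    let ?A = "Poly_Mapping.keys p \<union> Poly_Mapping.keys q"
    show "G (p + q) = G p + G q"
      using Poly_Mapping.keys_add[of p q]
      by (simp add: G[of ?A] lookup_add scaleR_add_left sum.distrib)
    have "Poly_Mapping.keys (c *\<^sub>R p) \<subseteq> Poly_Mapping.keys p"
      by (auto simp: in_keys_iff lookup_scaleR)
    then show "G (c *\<^sub>R p) = c *\<^sub>R G p"
      by (simp add: G[of "Poly_Mapping.keys p"] lookup_scaleR scaleR_sum_right)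
  qed
  have G_single: "G (Poly_Mapping.single xs 1) = F xs" for xs
    by (simp add: G_def)
  have G_rel: "G r = 0" if "r \<in> multilinear_relations" for r
    using that
  proof cases
    case (1 us x y vs)
    then show ?thesis
      using linear_add[OF F[unfolded multilinear_def, rule_format, of us vs], of x y]
      by (simp add: linear_diff[OF linG] G_single)
  next
    case (2 us c x vs)
    then show ?thesis
      using linear_scale[OF F[unfolded multilinear_def, rule_format, of us vs], of c x]
      by (simp add: linear_diff[OF linG] linear_scale[OF linG] G_single)
  qed
  have G_eq: "G p = G q" if "p - q \<in> span multilinear_relations" for p q
  proof -
    have "G (p - q) = 0"
      by (rule linear_eq_0_on_span[OF linG _ that]) (rule G_rel)
    then show ?thesis by (simp add: linear_diff[OF linG])
  qed
  have G_rep: "G (rep_tensor (abs_tensor p)) = G p" for p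
    by (rule G_eq) (simp flip: tensor.abs_eq_iff add: Quotient3_abs_rep[OF Quotient3_tensor])
  define L where "L t = G (rep_tensor t)" for t
  have L_abs: "L (abs_tensor p) = G p" for p by (simp add: L_def G_rep)
  have "linear L"
  proof (rule linearI)
    fix s t :: "'v tensor" and c :: real
    obtain p q where "s = abs_tensor p" "t = abs_tensor q"
      using ex_abs_tensor[of s] ex_abs_tensor[of t] by blast
    then show "L (s + t) = L s + L t" "L (c *\<^sub>R s) = c *\<^sub>R L s"
      by (simp_all add: plus_tensor.abs_eq scaleR_tensor.abs_eq L_abs linear_add[OF linG]
          linear_scale[OF linG])
  qed
  moreover have "L (tensor xs) = F xs" for xs
    by (simp add: tensor.abs_eq L_abs G_single)
  ultimately show ?thesis by blast
qed

lemma tensor_lift: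
  fixes F :: "'v::real_vector list \<Rightarrow> 'w::real_vector"
  assumes "multilinear F"
  shows "linear (tensor_lift F)" and "tensor_lift F (tensor xs) = F xs"
proof -
  have "\<exists>!L. linear L \<and> (\<forall>xs. L (tensor xs) = F xs)"
    using ex_tensor_lift[OF assms] by (metis tensor_lift_unique)
  from theI'[OF this] show "linear (tensor_lift F)" "tensor_lift F (tensor xs) = F xs"
    unfolding tensor_lift_def by blast+
qed

lemma multilinear_prod_nth:
  fixes f :: "nat \<Rightarrow> 'v::real_vector \<Rightarrow> real"
  assumes "\<And>i. linear (f i)"
  shows "multilinear (\<lambda>xs. if length xs = n then \<Prod>i<n. f i (xs ! i) else 0)"
  unfolding multilinear_def
proof (intro allI)
  fix us vs :: "'v list"
  let ?m = "length us"
  show "linear (\<lambda>x. if length (us @ x # vs) = n then \<Prod>i<n. f i ((us @ x # vs) ! i) else 0)"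
  proof (cases "length (us @ undefined # vs) = n")
    case True
    then have m: "?m \<in> {..<n}" by auto
    define c where "c = (\<Prod>i\<in>{..<n} - {?m}. f i ((us @ undefined # vs) ! i))"
    have "(\<Prod>i<n. f i ((us @ x # vs) ! i)) = f ?m x * c" for x
    proof -
      have "(\<Prod>i\<in>{..<n} - {?m}. f i ((us @ x # vs) ! i)) = c"
        unfolding c_def by (rule prod.cong) (auto simp: nth_append nth_Cons')
      then show ?thesis
        by (simp add: prod.remove[OF _ m])
    qed
    moreover have "linear (\<lambda>x. f ?m x * c)"
      by (rule linearI) (simp_all add: linear_add[OF assms] linear_scale[OF assms] algebra_simps)
    ultimately show ?thesis using True by simp
  next
    case False
    then show ?thesis by (auto intro!: linearI)
  qed
qed

lemma tensor_basis:
  fixes B :: "'v::real_vector set"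
  assumes B: "independent B" "span B = UNIV"
  shows "independent (tensor ` lists B)" and "span (tensor ` lists B) = UNIV"
    and "inj_on tensor (lists B)"
proof -
  define r where "r b x = representation B x b" for b x
  have lin_r: "linear (r b)" for b
    unfolding r_def by (rule linearI) (simp_all add: representation_add[OF B(1)] representation_scale[OF B(1)] B(2))
  have r: "r b x = (if x = b then 1 else 0)" if "x \<in> B" for b x
    using representation_basis[OF B(1) that] by (auto simp: r_def)
  define F where "F zs = (\<lambda>xs. if length xs = length zs
      then \<Prod>i<length zs. r (zs ! i) (xs ! i) else 0)" for zs :: "'v list"
  have F: "multilinear (F zs)" for zs
    unfolding F_def by (rule multilinear_prod_nth[OF lin_r])
  have F_eq: "F zs xs = (if xs = zs then 1 else 0)" if "xs \<in> lists B" for xs zs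
  proof -
    have "(\<Prod>i<length zs. r (zs ! i) (xs ! i)) = (\<Prod>i<length zs. if xs ! i = zs ! i then 1 else 0)"
      if "length xs = length zs"
    proof (rule prod.cong[OF refl])
      fix i assume "i \<in> {..<length zs}"
      then have "xs ! i \<in> B" using that \<open>xs \<in> lists B\<close> by (auto simp: in_lists_conv_set)
      then show "r (zs ! i) (xs ! i) = (if xs ! i = zs ! i then 1 else 0)" by (rule r)
    qed
    then show ?thesis
      by (auto simp: F_def list_eq_iff_nth_eq intro!: prod_zero)
  qed
  have L: "tensor_lift (F zs) (tensor xs) = (if xs = zs then 1 else 0)" if "xs \<in> lists B" for xs zs
    by (simp add: tensor_lift(2)[OF F] F_eq[OF that])
  show inj: "inj_on tensor (lists B)"
    by (rule inj_onI) (metis L zero_neq_one)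
  show "independent (tensor ` lists B)"
    unfolding independent_explicit_module
  proof (intro allI impI)
    fix t u v
    assume t: "finite t" "t \<subseteq> tensor ` lists B" "(\<Sum>w\<in>t. u w *\<^sub>R w) = 0" "v \<in> t"
    then obtain zs where zs: "zs \<in> lists B" "v = tensor zs" by auto
    have "0 = tensor_lift (F zs) (\<Sum>w\<in>t. u w *\<^sub>R w)"
      using t(3) linear_0[OF tensor_lift(1)[OF F]] by simp
    also have "\<dots> = (\<Sum>w\<in>t. u w * tensor_lift (F zs) w)"
      by (simp add: linear_sum[OF tensor_lift(1)[OF F]] linear_scale[OF tensor_lift(1)[OF F]])
    also have "\<dots> = (\<Sum>w\<in>t. if w = v then u w else 0)"
    proof (rule sum.cong[OF refl])
      fix w assume "w \<in> t"
      then obtain xs where "xs \<in> lists B" "w = tensor xs" using t(2) by auto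
      then show "u w * tensor_lift (F zs) w = (if w = v then u w else 0)"
        using L[of xs zs] zs inj_onD[OF inj, of xs zs] by auto
    qed
    also have "\<dots> = u v" using t by simp
    finally show "u v = 0" by simp
  qed
  have "tensor (us @ xs) \<in> span (tensor ` lists B)" if "us \<in> lists B" for us xs
    using that
  proof (induction xs arbitrary: us)
    case Nil
    then show ?case by (auto intro: span_base)
  next
    case (Cons x xs)
    have lin: "linear (\<lambda>x. tensor (us @ x # xs))"
      using multilinear_tensor unfolding multilinear_def by blast
    have "x \<in> span B" by (simp add: B(2))
    then have "tensor (us @ x # xs) \<in> span ((\<lambda>x. tensor (us @ x # xs)) ` B)"
      unfolding linear_span_image[OF lin] by blast
    also have "\<dots> \<subseteq> span (tensor ` lists B)"
    proof (intro span_minimal image_subsetI subspace_span)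
      fix b assume "b \<in> B"
      then show "tensor (us @ b # xs) \<in> span (tensor ` lists B)"
        using Cons.IH[of "us @ [b]"] Cons.prems by simp
    qed
    finally show ?case .
  qed
  from this[of "[]"] have "range tensor \<subseteq> span (tensor ` lists B)" by auto
  then have "span (range tensor) \<subseteq> span (tensor ` lists B)" by (rule span_minimal) simp
  then show "span (tensor ` lists B) = UNIV" by (auto simp: span_tensor)
qed

lemma multilinear_tensor_map2:
  fixes g :: "'u \<Rightarrow> 'v::real_vector \<Rightarrow> 'w::real_vector"
  assumes "\<And>u. linear (g u)"
  shows "multilinear (\<lambda>ys. if length xs = length ys then tensor (map2 g xs ys) else 0)"
  unfolding multilinear_def
proof (intro allI)
  fix us vs :: "'v list"
  let ?m = "length us"
  show "linear (\<lambda>y. if length xs = length (us @ y # vs) then tensor (map2 g xs (us @ y # vs)) else 0)"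
  proof (cases "length xs = length (us @ undefined # vs)")
    case True
    then have "xs = take ?m xs @ xs ! ?m # drop (Suc ?m) xs"
      by (simp add: id_take_nth_drop)
    moreover have "length (take ?m xs) = ?m" using True by simp
    ultimately obtain xs1 x xs2 where xs: "xs = xs1 @ x # xs2" "length xs1 = ?m" by blast
    have "linear (\<lambda>y. tensor (map2 g xs1 us @ g x y # map2 g xs2 vs))"
      using linear_compose[OF assms[of x] multilinear_tensor[unfolded multilinear_def, rule_format]]
      by (simp add: o_def)
    then show ?thesis using True xs by simp
  next
    case False
    then show ?thesis by (auto intro!: linearI)
  qed
qed

lemma prod_list_map2:
  "length xs = length ys \<Longrightarrow> prod_list (map2 f xs ys) = (\<Prod>i<length ys. f (xs ! i) (ys ! i))"
  for f :: "'a \<Rightarrow> 'b \<Rightarrow> real"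
  by (induction xs ys rule: list_induct2) (simp_all add: prod.lessThan_Suc_shift del: prod.lessThan_Suc)

lemma tensor_mult_tensor:
  "tensor_mult (tensor xs) (tensor ys) =
    (if length xs = length ys then tensor (map2 (*) xs ys) else 0)"
proof -
  have swap: "map2 (*) xs ys = map2 (\<lambda>y x. x * y) ys xs" for xs ys :: "'a list"
    by (simp add: zip_commute[of xs ys] split_def)
  have 1: "multilinear (\<lambda>ys :: 'a list. if length xs = length ys then tensor (map2 (*) xs ys) else 0)"
    for xs :: "'a list"
    by (rule multilinear_tensor_map2) (auto intro!: linearI simp: distrib_left)
  have 2: "multilinear (\<lambda>xs :: 'a list. if length ys = length xs
      then tensor (map2 (\<lambda>y x. x * y) ys xs) else 0)"
    by (rule multilinear_tensor_map2) (auto intro!: linearI simp: distrib_right)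
  have "tensor_mult (tensor xs) (tensor ys) =
      tensor_lift (\<lambda>xs. if length ys = length xs
        then tensor (map2 (\<lambda>y x. x * y) ys xs) else 0) (tensor xs)"
    unfolding tensor_mult_def tensor_lift(2)[OF 1]
    by (intro arg_cong2[where f = tensor_lift] ext refl) (auto simp: swap)
  also have "\<dots> = (if length xs = length ys then tensor (map2 (*) xs ys) else 0)"
    unfolding tensor_lift(2)[OF 2] by (simp add: swap)
  finally show ?thesis .
qed

lemma tensor_inner_tensor:
  "tensor_inner (tensor xs) (tensor ys) =
    (if length xs = length ys then prod_list (map2 (\<bullet>) xs ys) else 0)"
proof -
  have lin: "linear (\<lambda>y. x \<bullet> y)" "linear (\<lambda>y. y \<bullet> x)" for x :: 'a
    by (auto intro!: linearI simp: inner_add_left inner_add_right)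
  have eq: "(if length xs = length ys then prod_list (map2 (\<bullet>) xs ys) else 0) =
      (if length ys = length xs then \<Prod>i<length xs. xs ! i \<bullet> ys ! i else 0)" for xs ys :: "'a list"
    by (auto simp: prod_list_map2)
  have eq': "(if length ys = length xs then \<Prod>i<length xs. xs ! i \<bullet> ys ! i else 0) =
      (if length xs = length ys then \<Prod>i<length ys. xs ! i \<bullet> ys ! i else 0)" for xs ys :: "'a list"
    by auto
  have 1: "multilinear (\<lambda>ys :: 'a list. if length ys = length xs
      then \<Prod>i<length xs. xs ! i \<bullet> ys ! i else 0)" for xs
    by (rule multilinear_prod_nth) (rule lin)
  have 2: "multilinear (\<lambda>xs :: 'a list. if length xs = length ys
      then \<Prod>i<length ys. xs ! i \<bullet> ys ! i else 0)"
    by (rule multilinear_prod_nth) (rule lin)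
  show ?thesis
    unfolding tensor_inner_def eq tensor_lift(2)[OF 1] unfolding eq' tensor_lift(2)[OF 2] ..
qed

lemma hopf_power_matrix_eq:
  assumes "independent (B n)" "finite (B n)" "hopf_power H \<Delta> a x \<in> span (B n)" "x \<in> B n"
    and "\<And>y. y \<in> B n \<Longrightarrow> rescaling H \<Delta> B n y > 0"
  shows "(1 / real a ^ n) *\<^sub>R hopf_power H \<Delta> a x =
    (\<Sum>y\<in>B n. (rescaling H \<Delta> B n x / rescaling H \<Delta> B n y * hopf_power_matrix H \<Delta> B a n x y) *\<^sub>R y)"
proof -
  define v where "v = (1 / real a ^ n) *\<^sub>R hopf_power H \<Delta> a x"
  have "v \<in> span (B n)" unfolding v_def by (rule span_scale[OF assms(3)])
  then have "v = (\<Sum>y\<in>B n. representation (B n) v y *\<^sub>R y)"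
    using sum_representation_eq[OF assms(1) _ assms(2) subset_refl] by simp
  also have "\<dots> = (\<Sum>y\<in>B n. (rescaling H \<Delta> B n x / rescaling H \<Delta> B n y *
      hopf_power_matrix H \<Delta> B a n x y) *\<^sub>R y)"
  proof (rule sum.cong[OF refl])
    fix y assume "y \<in> B n"
    then show "representation (B n) v y *\<^sub>R y = (rescaling H \<Delta> B n x / rescaling H \<Delta> B n y *
        hopf_power_matrix H \<Delta> B a n x y) *\<^sub>R y"
      using assms(5)[of y] assms(5)[OF assms(4)]
      by (simp add: hopf_power_matrix_def v_def)
  qed
  finally show ?thesis unfolding v_def .
qed

end

theory Submission
  imports Defs
begin

text \<open>
  Since product and coproduct are adjoint, \<open>\<Psi>\<^sup>a\<close> is self-adjoint, and \<open>\<eta>(x) = \<langle>p\<^sup>n, x\<rangle>\<close> where \<open>p\<close> is the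
  sum of \<open>c / \<langle>c, c\<rangle>\<close> over \<open>c \<in> \<B>\<^sub>1\<close>.  As \<open>\<Psi>\<^sup>a(p\<^sup>n) = a\<^sup>n p\<^sup>n\<close>, the rows of the transition matrix sum to 1, and
  the weights \<open>\<eta>(x)\<^sup>2 / \<langle>x, x\<rangle>\<close> satisfy detailed balance.  For uniqueness, the primitive elements are the
  orthogonal complement of the products of elements of positive degree; hence they commute and
  generate \<open>\<H>\<close>, and a product of \<open>k\<close> primitives is an eigenvector of \<open>\<Psi>\<^sup>a\<close> with eigenvalue \<open>a\<^sup>k\<close>.  A
  stationary distribution \<open>\<pi>\<close> gives the eigenvector \<open>\<Sum>x. \<pi>(x) / \<eta>(x) x\<close> with eigenvalue \<open>a\<^sup>n\<close>, which is
  orthogonal to all products of fewer than \<open>n\<close> primitives.  It is therefore determined by its inner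
  product with the only \<open>n\<close>-fold product of elements of \<open>\<B>\<^sub>1\<close> of the given multidegree.
\<close>

section \<open>Bilinear maps on tensors\<close>

text \<open>Pure tensors span, and on a pure tensor the lift is \<open>F x xs\<close>. Linearity in
  the parameter \<open>x\<close> therefore passes through \<open>tensor_lift\<close> by induction
  over the span.\<close>

lemma linear_tensor_lift_family:
  assumes "\<And>x. multilinear (F x)" "\<And>ys. linear (\<lambda>x. F x ys)"
  shows "linear (\<lambda>x. tensor_lift (F x) t)"
proof -
  have "t \<in> span (range tensor)" by (simp add: span_tensor)
  then show ?thesis
  proof (induction rule: span_induct_alt)
    case base
    have "linear (\<lambda>x. 0)" by (auto intro!: linearI)
    then show ?case by (simp add: linear_0[OF tensor_lift(1)[OF assms(1)]])
  next
    case (step c s t)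
    then obtain xs where xs: "s = tensor xs" by auto
    have "tensor_lift (F x) (c *\<^sub>R s + t) = c *\<^sub>R F x xs + tensor_lift (F x) t" for x
      by (simp add: linear_add[OF tensor_lift(1)[OF assms(1)]]
          linear_scale[OF tensor_lift(1)[OF assms(1)]] xs tensor_lift(2)[OF assms(1)])
    then show ?case
      using linear_compose_add[OF linear_compose_scale_right[OF assms(2)] step(2)] by simp
  qed
qed

text \<open>Nested lifts are the shape in which \<open>tensor_mult\<close> and
  \<open>tensor_inner\<close> are defined. The outer lift exists because the inner one depends
  linearly on each letter of \<open>xs\<close>.\<close>

lemma bilinear_tensor_lift2:
  assumes 1: "\<And>xs. multilinear (G xs)" and 2: "\<And>ys. multilinear (\<lambda>xs. G xs ys)"
  shows "bilinear (\<lambda>s t. tensor_lift (\<lambda>xs. tensor_lift (G xs) t) s)"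
proof -
  have inner: "multilinear (\<lambda>xs. tensor_lift (G xs) t)" for t
    unfolding multilinear_def
    by (intro allI linear_tensor_lift_family 1) (use 2 in \<open>simp add: multilinear_def\<close>)
  have lin: "linear (\<lambda>t. tensor_lift (G xs) t)" for xs
    by (rule tensor_lift(1)[OF 1])
  show "bilinear (\<lambda>s t. tensor_lift (\<lambda>xs. tensor_lift (G xs) t) s)"
    unfolding bilinear_def
    by (auto intro: tensor_lift(1) linear_tensor_lift_family inner lin)
qed

lemma bilinear_tensor_mult: "bilinear tensor_mult"
proof -
  \<comment> \<open>\<open>multilinear_tensor_map2\<close> gives multilinearity in the second list
    only. Flipping the operands yields it for the first list.\<close>
  have swap: "map2 (*) xs ys = map2 (\<lambda>y x. x * y) ys xs" for xs ys :: "'a list"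
    by (simp add: zip_commute[of xs ys] split_def)
  have 1: "multilinear (\<lambda>ys :: 'a list. if length xs = length ys then tensor (map2 (*) xs ys) else 0)"
    for xs :: "'a list"
    by (rule multilinear_tensor_map2) (auto intro!: linearI simp: distrib_left)
  have "multilinear (\<lambda>xs :: 'a list. if length ys = length xs
      then tensor (map2 (\<lambda>y x. x * y) ys xs) else 0)" for ys
    by (rule multilinear_tensor_map2) (auto intro!: linearI simp: distrib_right)
  moreover have "(\<lambda>xs. if length xs = length ys then tensor (map2 (*) xs ys) else 0) =
      (\<lambda>xs. if length ys = length xs then tensor (map2 (\<lambda>y x. x * y) ys xs) else 0)"
    for ys :: "'a list"
    by (intro ext) (auto simp: swap[of _ ys])
  ultimately have 2: "multilinear (\<lambda>xs :: 'a list. if length xs = length ys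
      then tensor (map2 (*) xs ys) else 0)" for ys
    by simp
  show ?thesis
    using bilinear_tensor_lift2[OF 1 2] by (simp add: tensor_mult_def[abs_def])
qed

lemma bilinear_tensor_inner: "bilinear tensor_inner"
proof -
  have lin: "linear (\<lambda>y. x \<bullet> y)" "linear (\<lambda>y. y \<bullet> x)" for x :: 'a
    by (auto intro!: linearI simp: inner_add_left inner_add_right)
  have 1: "multilinear (\<lambda>ys :: 'a list. if length ys = length xs
      then \<Prod>i<length xs. xs ! i \<bullet> ys ! i else 0)" for xs
    by (rule multilinear_prod_nth) (rule lin)
  have "multilinear (\<lambda>xs :: 'a list. if length xs = length ys
      then \<Prod>i<length ys. xs ! i \<bullet> ys ! i else 0)" for ys
    by (rule multilinear_prod_nth) (rule lin)
  moreover have "(\<lambda>xs. if length xs = length ys then \<Prod>i<length ys. xs ! i \<bullet> ys ! i else 0) =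
     (\<lambda>xs. if length ys = length xs then \<Prod>i<length xs. xs ! i \<bullet> ys ! i else 0)" for ys :: "'a list"
    by auto
  ultimately have 2: "multilinear (\<lambda>xs :: 'a list. if length ys = length xs
      then \<Prod>i<length xs. xs ! i \<bullet> ys ! i else 0)" for ys
    by simp
  have eq: "(if length xs = length ys then prod_list (map2 (\<bullet>) xs ys) else 0) =
      (if length ys = length xs then \<Prod>i<length xs. xs ! i \<bullet> ys ! i else 0)" for xs ys :: "'a list"
    by (auto simp: prod_list_map2)
  show ?thesis
    using bilinear_tensor_lift2[OF 1 2] by (simp add: tensor_inner_def[abs_def] eq)
qed

lemma linear_tensor_inner: "linear (tensor_inner s)" "linear (\<lambda>s. tensor_inner s t)"
  using bilinear_tensor_inner by (auto simp: bilinear_def)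

lemma tensor_inner_commute: "tensor_inner s t = tensor_inner t s"
  for s t :: "'v::real_inner tensor"
proof (rule linear_eq_on[of "\<lambda>s. tensor_inner s t" "tensor_inner t" s "range tensor"])
  fix s' assume "s' \<in> range (tensor :: 'v list \<Rightarrow> _)"
  then obtain xs where xs: "s' = tensor xs" by auto
  show "tensor_inner s' t = tensor_inner t s'"
    unfolding xs
  proof (rule linear_eq_on[of "tensor_inner (tensor xs)" "\<lambda>t. tensor_inner t (tensor xs)" t "range tensor"])
    fix t' assume "t' \<in> range (tensor :: 'v list \<Rightarrow> _)"
    then obtain ys where ys: "t' = tensor ys" by auto
    show "tensor_inner (tensor xs) t' = tensor_inner t' (tensor xs)"
      unfolding ys tensor_inner_tensor by (auto simp: prod_list_map2 inner_commute)
  qed (simp_all add: linear_tensor_inner span_tensor)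
qed (simp_all add: linear_tensor_inner span_tensor)

lemma bilinear_tensor2: "bilinear (\<otimes>)"
  using multilinear_tensor[unfolded multilinear_def, rule_format, of _ "[]"]
    multilinear_tensor[unfolded multilinear_def, rule_format, of "[]" "[_]"]
  by (auto simp: bilinear_def intro: multilinear_tensor[unfolded multilinear_def, rule_format, of "[_]" "[]", simplified])

lemma multilinear_prod_list: "multilinear (prod_list :: 'a::real_algebra_1 list \<Rightarrow> 'a)"
  unfolding multilinear_def by (auto intro!: linearI simp: algebra_simps)

lemma tensor_inner_tensor_Cons:
  "tensor_inner (tensor (x # xs)) (tensor (y # ys)) = (x \<bullet> y) * tensor_inner (tensor xs) (tensor ys)"
  by (simp add: tensor_inner_tensor)

text \<open>The universal property of the second tensor power, where the coproduct takes its values.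
  Extension by zero to the other tensor powers keeps the map multilinear on words of every
  length.\<close>

definition tensor2_lift :: "('v::real_vector \<Rightarrow> 'v \<Rightarrow> 'w::real_vector) \<Rightarrow> 'v tensor \<Rightarrow> 'w"
  where "tensor2_lift f = tensor_lift (\<lambda>xs. case xs of [u, v] \<Rightarrow> f u v | _ \<Rightarrow> 0)"

lemma tensor2_lift:
  assumes "bilinear f"
  shows "linear (tensor2_lift f)" and "tensor2_lift f (u \<otimes> v) = f u v"
proof -
  have "linear (\<lambda>x. case us @ x # vs of [u, v] \<Rightarrow> f u v | _ \<Rightarrow> 0)" for us vs
  proof -
    have 0: "(case xs of [u, v] \<Rightarrow> f u v | _ \<Rightarrow> 0) = 0" if "length xs \<noteq> 2" for xs
      using that by (auto split: list.split)
    consider v where "us = []" "vs = [v]" | u where "us = [u]" "vs = []" |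
      "length us + length vs \<noteq> 1"
      by (cases us; cases vs) auto
    then show ?thesis
    proof cases
      case 3
      then have 3: "(case us @ x # vs of [u, v] \<Rightarrow> f u v | _ \<Rightarrow> 0) = 0" for x
        by (intro 0) auto
      have "linear (\<lambda>x. 0)" by (auto intro!: linearI)
      then show ?thesis using 3 by simp
    qed (use assms in \<open>auto simp: bilinear_def\<close>)
  qed
  then have "multilinear (\<lambda>xs. case xs of [u, v] \<Rightarrow> f u v | _ \<Rightarrow> 0)"
    by (simp add: multilinear_def)
  from tensor_lift[OF this] show "linear (tensor2_lift f)" "tensor2_lift f (u \<otimes> v) = f u v"
    by (simp_all add: tensor2_lift_def)
qed

lemma tensor_spaces_mono: "V \<subseteq> V' \<Longrightarrow> W \<subseteq> W' \<Longrightarrow> tensor_spaces V W \<subseteq> tensor_spaces V' W'"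
  unfolding tensor_spaces_def by (rule span_mono) blast

lemma linear_eq_on_tensor_spaces:
  assumes "linear F" "linear G" "t \<in> tensor_spaces V W"
    and "\<And>v w. v \<in> V \<Longrightarrow> w \<in> W \<Longrightarrow> F (v \<otimes> w) = G (v \<otimes> w)"
  shows "F t = G t"
  by (rule linear_eq_on[OF assms(1,2) assms(3)[unfolded tensor_spaces_def]]) (use assms(4) in auto)

text \<open>The preimage of \<open>U\<close> is a subspace, so pure tensors suffice. Used with
  \<open>U\<close> a graded piece, to follow a grading through the coproduct, and with
  \<open>U = {0}\<close>, to prove orthogonality.\<close>

lemma linear_image_tensor_spaces:
  assumes "linear F" "subspace U" "t \<in> span (\<Union>i\<in>I. tensor_spaces (V i) (W i))"
    and "\<And>i v w. i \<in> I \<Longrightarrow> v \<in> V i \<Longrightarrow> w \<in> W i \<Longrightarrow> F (v \<otimes> w) \<in> U"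
  shows "F t \<in> U"
proof -
  have "tensor_spaces (V i) (W i) \<subseteq> F -` U" if "i \<in> I" for i
    unfolding tensor_spaces_def
    by (rule span_minimal) (use assms(4) that linear_subspace_vimage[OF assms(1,2)] in auto)
  then have "span (\<Union>i\<in>I. tensor_spaces (V i) (W i)) \<subseteq> F -` U"
    by (intro span_minimal) (use linear_subspace_vimage[OF assms(1,2)] in auto)
  then show ?thesis using assms(3) by blast
qed

section \<open>Adding a factor in front of a tensor\<close>

lemma linear_tensor_Cons_left: "linear (\<lambda>x. tensor (x # xs))"
  using multilinear_tensor[unfolded multilinear_def, rule_format, of "[]" xs] by simp

text \<open>Left multiplication by \<open>u\<close> in the tensor algebra.\<close>

definition tensor_Cons :: "'v::real_vector \<Rightarrow> 'v tensor \<Rightarrow> 'v tensor"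
  where "tensor_Cons u = tensor_lift (\<lambda>xs. tensor (u # xs))"

lemma multilinear_tensor_Cons: "multilinear (\<lambda>xs. tensor (u # xs))"
  unfolding multilinear_def
  using multilinear_tensor[unfolded multilinear_def, rule_format, of "u # us" for us] by simp

lemma tensor_Cons_tensor: "tensor_Cons u (tensor xs) = tensor (u # xs)"
  unfolding tensor_Cons_def by (rule tensor_lift(2)[OF multilinear_tensor_Cons])

lemma linear_tensor_Cons: "linear (tensor_Cons u)"
  unfolding tensor_Cons_def by (rule tensor_lift(1)[OF multilinear_tensor_Cons])

lemma bilinear_tensor_Cons: "bilinear tensor_Cons"
  unfolding bilinear_def
proof (intro conjI allI)
  fix t :: "'a tensor"
  show "linear (\<lambda>u. tensor_Cons u t)"
    unfolding tensor_Cons_def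
    by (rule linear_tensor_lift_family[OF multilinear_tensor_Cons linear_tensor_Cons_left])
qed (rule linear_tensor_Cons)

lemma bilinear_compose:
  assumes "bilinear f" "linear g" "linear h"
  shows "bilinear (\<lambda>x y. f (g x) (h y))"
  using assms linear_compose[OF assms(2), of "\<lambda>x. f x (h _)"] linear_compose[OF assms(3), of "f (g _)"]
  by (auto simp: bilinear_def o_def)

section \<open>Maps acting on a single tensor factor\<close>

lemma multilinear_tensor_append: "multilinear (\<lambda>ys. tensor (as @ ys @ bs))"
  unfolding multilinear_def
  using multilinear_tensor[unfolded multilinear_def, rule_format, of "as @ us" "vs @ bs" for us vs]
  by simp

lemma multilinear_insert:
  fixes f :: "'v::real_vector \<Rightarrow> 'v tensor"
  assumes f: "linear f"
  shows "multilinear (\<lambda>xs. if i < length xs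
      then tensor_lift (\<lambda>ys. tensor (take i xs @ ys @ drop (Suc i) xs)) (f (xs ! i)) else 0)"
  unfolding multilinear_def
proof (intro allI)
  fix us vs :: "'v list"
  note ml = multilinear_tensor_append
  show "linear (\<lambda>x. if i < length (us @ x # vs)
      then tensor_lift (\<lambda>ys. tensor (take i (us @ x # vs) @ ys @ drop (Suc i) (us @ x # vs)))
        (f ((us @ x # vs) ! i)) else 0)"
  proof -
    \<comment> \<open>The cases compare the index \<open>i\<close> with the position of the varying
      letter: \<open>i\<close> is outside the word, at that letter, to its left, or to its right.
      Only in the second case does \<open>f\<close> act on the varying letter.\<close>
    consider "i \<ge> length us + Suc (length vs)" | "i = length us" |
       "i < length us" | "i > length us" "i < length us + Suc (length vs)" by linarith
    then show ?thesis
    proof cases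
      case 1
      then show ?thesis by (auto intro!: linearI)
    next
      case 2
      then show ?thesis
        using linear_compose[OF f tensor_lift(1)[OF ml[of us vs]]] by (simp add: o_def)
    next
      case 3
      have "linear (\<lambda>x. tensor (take i us @ ys @ drop (Suc i) us @ x # vs))" for ys
        using multilinear_tensor[unfolded multilinear_def, rule_format,
            of "take i us @ ys @ drop (Suc i) us" vs] by simp
      from linear_tensor_lift_family[OF ml this]
      show ?thesis using 3 by (simp add: nth_append)
    next
      case 4
      then obtain j where j: "i = length us + Suc j" using less_iff_Suc_add by auto
      have "linear (\<lambda>x. tensor ((us @ x # take j vs) @ ys @ drop (Suc j) vs))" for ys
        using multilinear_tensor[unfolded multilinear_def, rule_format,
            of us "take j vs @ ys @ drop (Suc j) vs"] by simp
      from linear_tensor_lift_family[OF ml this]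
      show ?thesis using 4 by (simp add: j nth_append)
    qed
  qed
qed

lemma tensor_apply:
  fixes f :: "'v::real_vector \<Rightarrow> 'v tensor"
  assumes f: "linear f"
  shows "linear (tensor_apply i f)"
    and "i < length xs \<Longrightarrow> tensor_apply i f (tensor xs) =
      tensor_lift (\<lambda>ys. tensor (take i xs @ ys @ drop (Suc i) xs)) (f (xs ! i))"
  unfolding tensor_apply_def
  using tensor_lift[OF multilinear_insert[OF f, of i]] by simp_all

text \<open>Peeling off the first factor lowers the index by one. This allows the recursion of
  \<open>iterated_coproduct\<close>, which splits the last factor, to be rewritten so that it splits
  off the first.\<close>

lemma tensor_apply_Suc_Cons:
  fixes f :: "'v::real_vector \<Rightarrow> 'v tensor"
  assumes f: "linear f"
  shows "tensor_apply (Suc i) f (tensor_Cons u t) = tensor_Cons u (tensor_apply i f t)"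
proof -
  note ml = multilinear_tensor_append
  have "tensor_apply (Suc i) f \<circ> tensor_Cons u = tensor_Cons u \<circ> tensor_apply i f"
  proof (rule tensor_lift_unique)
    show "linear (tensor_apply (Suc i) f \<circ> tensor_Cons u)" "linear (tensor_Cons u \<circ> tensor_apply i f)"
      by (intro linear_compose linear_tensor_Cons tensor_apply(1) f)+
    fix xs
    show "(tensor_apply (Suc i) f \<circ> tensor_Cons u) (tensor xs) = (tensor_Cons u \<circ> tensor_apply i f) (tensor xs)"
    proof (cases "i < length xs")
      case True
      have "tensor_lift (\<lambda>ys. tensor ((u # as) @ ys @ bs)) =
          tensor_Cons u \<circ> tensor_lift (\<lambda>ys. tensor (as @ ys @ bs))" for as bs
        using ml[of "u # as" bs]
        by (intro tensor_lift_unique linear_compose linear_tensor_Cons tensor_lift(1) ml)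
          (simp_all add: tensor_lift(2) ml tensor_Cons_tensor)
      from fun_cong[OF this] True show ?thesis
        by (simp add: tensor_Cons_tensor tensor_apply(2)[OF f])
    next
      case False
      then show ?thesis
        by (simp add: tensor_Cons_tensor tensor_apply_def tensor_lift(2)[OF multilinear_insert[OF f]]
            linear_0[OF linear_tensor_Cons])
    qed
  qed
  from fun_cong[OF this, of t] show ?thesis by simp
qed

section \<open>The Hopf powers as convolution powers\<close>

context graded_connected_hopf_algebra
begin

lemma subspace_H: "subspace (H n)"
  and span_H: "span (\<Union>n. H n) = UNIV"
  using grading by (auto simp: direct_sum_def)

lemma coproduct_in_tensor_spaces: "\<Delta> x \<in> tensor_spaces UNIV UNIV"
proof -
  have sub: "subspace (tensor_spaces UNIV UNIV :: 'h tensor set)"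
    by (simp add: tensor_spaces_def)
  have "x \<in> span (\<Union>n. H n)" by (simp add: span_H)
  then show ?thesis
  proof (induction rule: span_induct_alt)
    case base
    then show ?case by (simp add: linear_0[OF linear_coproduct] subspace_0[OF sub])
  next
    case (step c y z)
    then obtain n where "y \<in> H n" by auto
    have "span (\<Union>j\<in>{0..n}. tensor_spaces (H j) (H (n - j))) \<subseteq> tensor_spaces UNIV UNIV"
      by (intro span_minimal UN_least sub tensor_spaces_mono) auto
    then have "\<Delta> y \<in> tensor_spaces UNIV UNIV"
      using coproduct_grading[OF \<open>y \<in> H n\<close>] by blast
    then show ?case
      using step by (simp add: linear_add[OF linear_coproduct] linear_scale[OF linear_coproduct]
          subspace_add[OF sub] subspace_scale[OF sub])
  qed
qed

text \<open>The working tool for identities involving \<open>\<Delta> x\<close>: no explicit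
  decomposition of the coproduct has to be chosen, since it lies in the span of the words of length
  two.\<close>

lemma linear_eq_coproduct:
  assumes "linear F" "linear G" "\<And>u v. F (u \<otimes> v) = G (u \<otimes> v)"
  shows "F (\<Delta> x) = G (\<Delta> x)"
  by (rule linear_eq_on_tensor_spaces[OF assms(1,2) coproduct_in_tensor_spaces assms(3)])

text \<open>Each step of \<open>iterated_coproduct\<close> splits the last factor, so everything
  after the first coproduct happens in its right factor. Linearity is carried along in the same
  induction because it makes the map under \<open>tensor2_lift\<close> bilinear.\<close>

lemma iterated_coproduct_Suc_Suc:
  shows "linear (iterated_coproduct H \<Delta> (Suc k))"
    and "iterated_coproduct H \<Delta> (Suc (Suc k)) x =
      tensor2_lift (\<lambda>u v. tensor_Cons u (iterated_coproduct H \<Delta> (Suc k) v)) (\<Delta> x)"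
proof (induction k arbitrary: x)
  case 0
  { case 1
    then show ?case
      using multilinear_tensor[unfolded multilinear_def, rule_format, of "[]" "[]"] by simp
  next
    case 2
    have bil: "bilinear (\<lambda>u v. tensor_Cons u (tensor [v]))"
      using bilinear_tensor2 by (simp add: tensor_Cons_tensor)
    have ml: "linear (tensor_lift tensor)" "tensor_lift tensor (tensor xs) = tensor xs" for xs :: "'h list"
      using tensor_lift[OF multilinear_tensor] by auto
    have "iterated_coproduct H \<Delta> (Suc (Suc 0)) x = tensor_lift tensor (\<Delta> x)"
      by (simp add: tensor_apply(2)[OF linear_coproduct])
    also have "\<dots> = tensor2_lift (\<lambda>u v. tensor_Cons u (tensor [v])) (\<Delta> x)"
      by (rule linear_eq_coproduct)
        (simp_all add: ml tensor2_lift[OF bilinear_tensor2] tensor_Cons_tensor)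
    finally show ?case by simp }
next
  case (Suc k)
  have eq: "iterated_coproduct H \<Delta> (Suc (Suc k)) =
      tensor_apply k \<Delta> \<circ> iterated_coproduct H \<Delta> (Suc k)"
    by (rule ext) simp
  have lin: "linear (iterated_coproduct H \<Delta> (Suc (Suc k)))"
    unfolding eq by (rule linear_compose[OF Suc(1) tensor_apply(1)[OF linear_coproduct]])
  have bil: "bilinear (\<lambda>u v. tensor_Cons u (iterated_coproduct H \<Delta> (Suc k) v))"
    by (rule bilinear_compose[OF bilinear_tensor_Cons linear_id Suc(1), unfolded id_def])
  have bil': "bilinear (\<lambda>u v. tensor_Cons u (iterated_coproduct H \<Delta> (Suc (Suc k)) v))"
    by (rule bilinear_compose[OF bilinear_tensor_Cons linear_id lin, unfolded id_def])
  { case 1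
    show ?case by (rule lin)
  next
    case 2
    have "iterated_coproduct H \<Delta> (Suc (Suc (Suc k))) x =
        tensor_apply (Suc k) \<Delta> (iterated_coproduct H \<Delta> (Suc (Suc k)) x)"
      by (rule iterated_coproduct.simps(3))
    also have "\<dots> = (tensor_apply (Suc k) \<Delta> \<circ>
          tensor2_lift (\<lambda>u v. tensor_Cons u (iterated_coproduct H \<Delta> (Suc k) v))) (\<Delta> x)"
      by (simp only: Suc(2) o_apply)
    also have "\<dots> = tensor2_lift (\<lambda>u v. tensor_Cons u (iterated_coproduct H \<Delta> (Suc (Suc k)) v)) (\<Delta> x)"
      by (rule linear_eq_coproduct,
          intro linear_compose tensor2_lift(1) bil tensor_apply(1) linear_coproduct,
          rule tensor2_lift(1)[OF bil'])
        (simp add: tensor2_lift(2)[OF bil] tensor2_lift(2)[OF bil']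
          tensor_apply_Suc_Cons[OF linear_coproduct] del: iterated_coproduct.simps(3)
          flip: iterated_coproduct.simps(3))
    finally show ?case . }
qed

lemma linear_hopf_power: "linear (hopf_power H \<Delta> (Suc k))"
  using linear_compose[OF iterated_coproduct_Suc_Suc(1) tensor_lift(1)[OF multilinear_prod_list]]
  by (simp add: hopf_power_def[abs_def] o_def)

lemma hopf_power_1: "hopf_power H \<Delta> (Suc 0) x = x"
  by (simp add: hopf_power_def tensor_lift(2)[OF multilinear_prod_list])

lemma bilinear_mult_hopf_power: "bilinear (\<lambda>u v. u * hopf_power H \<Delta> (Suc k) v)"
  by (rule bilinear_compose[OF bilinear_times linear_id linear_hopf_power, unfolded id_def])

lemma prod_tensor_Cons: "tensor_lift prod_list (tensor_Cons u t) = u * tensor_lift prod_list t"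
  for u :: 'h
proof -
  have lin: "linear ((*) u)" by (auto intro!: linearI simp: distrib_left)
  have "tensor_lift prod_list \<circ> tensor_Cons u = (*) u \<circ> tensor_lift prod_list"
    by (intro tensor_lift_unique linear_compose linear_tensor_Cons tensor_lift(1)
        multilinear_prod_list lin)
      (simp add: tensor_Cons_tensor tensor_lift(2)[OF multilinear_prod_list])
  from fun_cong[OF this, of t] show ?thesis by simp
qed

text \<open>Multiplying out the preceding recursion exhibits the Hopf power as the convolution of
  the identity with the next lower Hopf power. Later inductions on the exponent rest on this
  form.\<close>

lemma hopf_power_Suc_Suc:
  "hopf_power H \<Delta> (Suc (Suc k)) x = tensor2_lift (\<lambda>u v. u * hopf_power H \<Delta> (Suc k) v) (\<Delta> x)"
proof -
  have bil: "bilinear (\<lambda>u v. tensor_Cons u (iterated_coproduct H \<Delta> (Suc k) v))"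
    by (rule bilinear_compose[OF bilinear_tensor_Cons linear_id iterated_coproduct_Suc_Suc(1), unfolded id_def])
  have "(tensor_lift prod_list \<circ>
      tensor2_lift (\<lambda>u v. tensor_Cons u (iterated_coproduct H \<Delta> (Suc k) v))) (\<Delta> x) =
    tensor2_lift (\<lambda>u v. u * hopf_power H \<Delta> (Suc k) v) (\<Delta> x)"
    by (rule linear_eq_coproduct,
        intro linear_compose tensor2_lift(1) bil tensor_lift(1) multilinear_prod_list,
        rule tensor2_lift(1)[OF bilinear_mult_hopf_power])
      (simp add: tensor2_lift(2)[OF bil] tensor2_lift(2)[OF bilinear_mult_hopf_power]
        prod_tensor_Cons flip: hopf_power_def)
  then show ?thesis
    by (simp only: hopf_power_def iterated_coproduct_Suc_Suc o_apply)
qed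

text \<open>The convolution multiplies an element of \<open>M \<mu>\<close> by the Hopf power of an
  element of \<open>M \<mu>'\<close>. The index ranges over any commutative monoid, so that the
  lemma serves both the degree and the multidegree.\<close>

lemma hopf_power_in_graded_piece:
  fixes M :: "'i::comm_monoid_add \<Rightarrow> 'h set"
  assumes sub: "\<And>\<nu>. subspace (M \<nu>)"
    and mult: "\<And>\<mu> \<nu> x y. x \<in> M \<mu> \<Longrightarrow> y \<in> M \<nu> \<Longrightarrow> x * y \<in> M (\<mu> + \<nu>)"
    and cop: "\<And>\<nu> x. x \<in> M \<nu> \<Longrightarrow>
      \<Delta> x \<in> span (\<Union>(\<mu>, \<mu>')\<in>{(\<mu>, \<mu>'). \<mu> + \<mu>' = \<nu>}. tensor_spaces (M \<mu>) (M \<mu>'))"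
    and x: "x \<in> M \<nu>"
  shows "hopf_power H \<Delta> (Suc k) x \<in> M \<nu>"
  using x
proof (induction k arbitrary: x \<nu>)
  case 0
  then show ?case by (simp add: hopf_power_1)
next
  case (Suc k)
  show ?case
    unfolding hopf_power_Suc_Suc
  proof (rule linear_image_tensor_spaces)
    show "linear (tensor2_lift (\<lambda>u v. u * hopf_power H \<Delta> (Suc k) v))"
      by (rule tensor2_lift(1)[OF bilinear_mult_hopf_power])
    show "\<Delta> x \<in> span (\<Union>p\<in>{(\<mu>, \<mu>'). \<mu> + \<mu>' = \<nu>}. tensor_spaces (M (fst p)) (M (snd p)))"
      using cop[OF Suc.prems] by (simp add: case_prod_unfold)
    show "tensor2_lift (\<lambda>u v. u * hopf_power H \<Delta> (Suc k) v) (v \<otimes> w) \<in> M \<nu>"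
      if "p \<in> {(\<mu>, \<mu>'). \<mu> + \<mu>' = \<nu>}" "v \<in> M (fst p)" "w \<in> M (snd p)" for p v w
      using that mult[OF that(2) Suc.IH[OF that(3)]]
      by (auto simp: tensor2_lift(2)[OF bilinear_mult_hopf_power])
  qed (rule sub)
qed

end

section \<open>Orthogonal bases\<close>

lemma inner_eq_0_on_span:
  fixes S T :: "'v::real_inner set"
  assumes "\<And>x y. x \<in> S \<Longrightarrow> y \<in> T \<Longrightarrow> x \<bullet> y = 0" "x \<in> span S" "y \<in> span T"
  shows "x \<bullet> y = 0"
proof -
  have "x \<bullet> y = 0" if "x \<in> S" for x
    by (rule linear_eq_0_on_span[OF _ _ assms(3), of "\<lambda>y. x \<bullet> y"])
      (auto intro!: linearI simp: inner_add_right assms(1) that)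
  then show ?thesis
    by (rule linear_eq_0_on_span[OF _ _ assms(2), of "\<lambda>x. x \<bullet> y", rotated])
      (auto intro!: linearI simp: inner_add_left)
qed

text \<open>Only the finitely many non-zero coordinates enter, so \<open>S\<close> may be infinite;
  it is applied to the union of all \<open>B n\<close>.\<close>

lemma representation_orthogonal:
  fixes S :: "'v::real_inner set"
  assumes S: "pairwise orthogonal S" "independent S" "x \<in> span S" "y \<in> S"
  shows "representation S x y = (x \<bullet> y) / (y \<bullet> y)"
proof -
  let ?R = "{b. representation S x b \<noteq> 0}"
  have "y \<noteq> 0" using S(2,4) dependent_zero by blast
  have "x \<bullet> y = (\<Sum>b\<in>?R. representation S x b *\<^sub>R b) \<bullet> y"
    by (simp add: sum_nonzero_representation_eq[OF S(2,3)])
  also have "\<dots> = (\<Sum>b\<in>?R. if b = y then representation S x y * (y \<bullet> y) else 0)"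
    unfolding inner_sum_left
    using S(1,4) representation_ne_zero[of S x]
    by (intro sum.cong) (auto simp: pairwise_def orthogonal_def)
  also have "\<dots> = representation S x y * (y \<bullet> y)"
    using finite_representation[of S x] by (simp add: sum.delta)
  finally show ?thesis using \<open>y \<noteq> 0\<close> by simp
qed

lemma orthogonal_expansion:
  fixes S :: "'v::real_inner set"
  assumes S: "pairwise orthogonal S" "independent S" "finite S" "x \<in> span S"
  shows "x = (\<Sum>y\<in>S. ((x \<bullet> y) / (y \<bullet> y)) *\<^sub>R y)"
proof -
  have "x = (\<Sum>y\<in>S. representation S x y *\<^sub>R y)"
    using sum_representation_eq[OF S(2,4,3)] by simp
  then show ?thesis
    by (simp add: representation_orthogonal[OF S(1,2,4)] cong: sum.cong)
qed

text \<open>The ambient space may be infinite-dimensional, but a finite set has an orthogonal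
  spanning set \<open>C\<close> for its span, and the Fourier sum over \<open>C\<close> is the
  projection.\<close>

lemma orthogonal_projection_exists:
  fixes T :: "'v::real_inner set"
  assumes "finite T"
  obtains d where "d \<in> span T" "\<And>t. t \<in> span T \<Longrightarrow> t \<bullet> (x - d) = 0"
proof -
  obtain C where C: "finite C" "span C = span T" "pairwise orthogonal C"
    using basis_orthogonal[OF assms] by blast
  define d where "d = (\<Sum>b\<in>C. ((b \<bullet> x) / (b \<bullet> b)) *\<^sub>R b)"
  have "b \<bullet> (x - d) = 0" if b: "b \<in> C" for b
  proof -
    have "b \<bullet> d = (\<Sum>c\<in>C. if c = b then b \<bullet> x else 0)"
      unfolding d_def inner_sum_right
      using C(3) b by (intro sum.cong) (auto simp: pairwise_def orthogonal_def inner_commute)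
    then show ?thesis using C(1) b by (simp add: inner_diff_right)
  qed
  then have "t \<bullet> (x - d) = 0" if "t \<in> span T" for t
    using inner_eq_0_on_span[of C "{x - d}" t "x - d"] that C(2) by (auto simp: span_base)
  moreover have "d \<in> span T"
    unfolding d_def C(2)[symmetric] by (intro span_sum span_scale span_base)
  ultimately show thesis by (rule that[rotated])
qed

text \<open>Otherwise \<open>x\<close> in one summand and \<open>-x\<close> in the other would be a
  non-trivial relation.\<close>

lemma direct_sum_Int:
  assumes V: "direct_sum I V W" and ij: "i \<in> I" "j \<in> I" "i \<noteq> j" and x: "x \<in> V i" "x \<in> V j"
  shows "x = 0"
proof -
  define f where "f k = (if k = i then x else - x)" for k
  have "subspace (V j)" using V ij by (auto simp: direct_sum_def)
  then have "\<forall>k\<in>{i, j}. f k \<in> V k"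
    using x subspace_neg[of "V j" x] by (auto simp: f_def)
  moreover have "sum f {i, j} = 0" using ij(3) by (simp add: f_def)
  ultimately have "\<forall>k\<in>{i, j}. f k = 0"
    using V ij unfolding direct_sum_def by (metis empty_subsetI finite.emptyI finite.insertI insert_subset)
  then show ?thesis by (simp add: f_def)
qed

section \<open>Orthogonality and structure constants under an adjoint inner product\<close>

locale orthogonal_state_space = graded_connected_hopf_algebra H \<Delta>
  for H :: "nat \<Rightarrow> 'h::{real_algebra_1, real_inner} set" and \<Delta> :: "'h \<Rightarrow> 'h tensor" +
  fixes B :: "nat \<Rightarrow> 'h set"
  assumes finite_dim: "\<exists>S. finite S \<and> span S = H n"
    and adjoint: "(w * z) \<bullet> x = tensor_inner (w \<otimes> z) (\<Delta> x)"
    and state_space: "state_space_basis H \<Delta> B"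
    and orthogonal_basis: "pairwise orthogonal (\<Union>n. B n)"
    and decomposable:
      "n > 1 \<Longrightarrow> y \<in> B n \<Longrightarrow> \<exists>i>0. \<exists>j>0. \<exists>w\<in>B i. \<exists>z\<in>B j. product_coeff B [w, z] y \<noteq> 0"
begin

abbreviation basis :: "'h set" where "basis \<equiv> \<Union>n. B n"

lemma independent_B: "independent (B n)"
  and span_B: "span (B n) = H n"
  and B_0: "B 0 = {1}"
  using state_space by (auto simp: state_space_basis_def graded_basis_def)

lemma finite_B: "finite (B n)"
proof -
  obtain S where "finite S" "span S = H n" using finite_dim by blast
  then show ?thesis
    using independent_span_bound[OF \<open>finite S\<close> independent_B[of n]] span_superset[of "B n"] span_B by auto
qed

lemma B_in_H: "x \<in> B n \<Longrightarrow> x \<in> H n"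
  using span_B span_base by blast

lemma basis_nonzero: "x \<in> basis \<Longrightarrow> x \<noteq> 0"
  using independent_B dependent_zero by blast

lemma inner_basis: "x \<in> basis \<Longrightarrow> y \<in> basis \<Longrightarrow> x \<noteq> y \<Longrightarrow> x \<bullet> y = 0"
  using orthogonal_basis by (auto simp: pairwise_def orthogonal_def)

lemma inner_basis_pos: "x \<in> basis \<Longrightarrow> x \<bullet> x > 0"
  using basis_nonzero by simp

lemma independent_basis: "independent basis"
  by (rule pairwise_orthogonal_independent[OF orthogonal_basis]) (use basis_nonzero in blast)

lemma span_basis: "span basis = UNIV"
proof -
  have "H n \<subseteq> span basis" for n
    unfolding span_B[symmetric] by (rule span_mono) auto
  then have "span (\<Union>n. H n) \<subseteq> span basis" by (intro span_minimal) auto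
  then show ?thesis by (simp add: span_H top.extremum_uniqueI)
qed

lemma H_Int: "x \<in> H i \<Longrightarrow> x \<in> H j \<Longrightarrow> i \<noteq> j \<Longrightarrow> x = 0"
  by (rule direct_sum_Int[OF grading UNIV_I UNIV_I])

text \<open>A non-zero vector lies in at most one graded piece, so basis elements of different
  degrees are different vectors and hence orthogonal.\<close>

lemma inner_H:
  assumes "x \<in> H i" "y \<in> H j" "i \<noteq> j"
  shows "x \<bullet> y = 0"
proof (rule inner_eq_0_on_span)
  show "x \<in> span (B i)" "y \<in> span (B j)" using assms span_B by auto
  fix u v assume uv: "u \<in> B i" "v \<in> B j"
  then have "u \<noteq> v" using H_Int[of u i j] B_in_H basis_nonzero assms(3) by blast
  with uv show "u \<bullet> v = 0" using inner_basis by blast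
qed

lemma one_in_H: "1 \<in> H 0"
  using B_0 B_in_H by auto

text \<open>Adjointness at the unit says that this number equals its own square, and it is non-zero
  because \<open>1\<close> is.\<close>

lemma inner_one: "(1::'h) \<bullet> 1 = 1"
proof -
  have "(1::'h) \<bullet> 1 = ((1::'h) \<bullet> 1) * ((1::'h) \<bullet> 1)"
    using adjoint[of 1 1 1] by (simp add: coproduct_one tensor_inner_tensor)
  then show ?thesis by simp
qed

text \<open>By adjointness the number \<open>(w * z) \<bullet> y\<close> governs the product and the
  coproduct alike, up to positive factors. From here on positivity is expressed through it.\<close>

lemma product_coeff_nonneg:
  assumes "w \<in> basis" "z \<in> basis" "y \<in> basis"
  shows "product_coeff B [w, z] y = ((w * z) \<bullet> y) / (y \<bullet> y)" and "(w * z) \<bullet> y \<ge> 0"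
proof -
  show eq: "product_coeff B [w, z] y = ((w * z) \<bullet> y) / (y \<bullet> y)"
    using representation_orthogonal[OF orthogonal_basis independent_basis _ assms(3), of "w * z"]
    by (simp add: product_coeff_def span_basis)
  have "product_coeff B [w, z] y \<ge> 0"
    using state_space assms unfolding state_space_basis_def by blast
  then show "(w * z) \<bullet> y \<ge> 0"
    using inner_basis_pos[OF assms(3)] by (simp add: eq zero_le_divide_iff)
qed

section \<open>Coordinates of tensors and of the coproduct\<close>

lemma tensor_inner_basis:
  "cs \<in> lists basis \<Longrightarrow> ds \<in> lists basis \<Longrightarrow>
    tensor_inner (tensor cs) (tensor ds) = (if cs = ds then \<Prod>c\<leftarrow>cs. c \<bullet> c else 0)"
proof (induction cs arbitrary: ds)
  case Nil
  then show ?case by (cases ds) (auto simp: tensor_inner_tensor)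
next
  case (Cons c cs)
  show ?case
  proof (cases ds)
    case Nil
    then show ?thesis by (simp add: tensor_inner_tensor)
  next
    case ds: (Cons d ds')
    have "c \<noteq> d \<Longrightarrow> c \<bullet> d = 0"
      using Cons.prems ds by (intro inner_basis) auto
    then show ?thesis
      using Cons.IH[of ds'] Cons.prems ds by (auto simp: tensor_inner_tensor_Cons)
  qed
qed

text \<open>The counterpart of \<open>representation_orthogonal\<close> for
  \<open>tensor_inner\<close>, which is a bilinear form and not the inner product of a type class.
  Two linear functions of \<open>t\<close> are compared on basis words instead.\<close>

lemma representation_tensor:
  assumes cs: "cs \<in> lists basis"
  shows "representation (tensor ` lists basis) t (tensor cs) =
    tensor_inner (tensor cs) t / (\<Prod>c\<leftarrow>cs. c \<bullet> c)"
proof -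
  let ?T = "tensor ` lists basis"
  note T = tensor_basis[OF independent_basis span_basis]
  have prod: "(\<Prod>c\<leftarrow>cs. c \<bullet> c) \<noteq> 0"
    using cs inner_basis_pos by (induction cs) auto
  have "tensor_inner (tensor cs) t = (\<Prod>c\<leftarrow>cs. c \<bullet> c) * representation ?T t (tensor cs)"
  proof (rule linear_eq_on[where f = "tensor_inner (tensor cs)" and B = ?T
        and g = "\<lambda>t. (\<Prod>c\<leftarrow>cs. c \<bullet> c) * representation ?T t (tensor cs)"])
    show "linear (tensor_inner (tensor cs))" by (rule linear_tensor_inner)
    show "linear (\<lambda>t. (\<Prod>c\<leftarrow>cs. c \<bullet> c) * representation ?T t (tensor cs))"
      by (rule linearI) (simp_all add: T(2) representation_add[OF T(1)] representation_scale[OF T(1)] algebra_simps)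
    show "t \<in> span ?T" by (simp add: T(2))
    fix s assume "s \<in> ?T"
    then obtain ds where ds: "ds \<in> lists basis" "s = tensor ds" by auto
    have "representation ?T s (tensor cs) = (if cs = ds then 1 else 0)"
      unfolding representation_basis[OF T(1) \<open>s \<in> ?T\<close>]
      by (simp only: ds(2) inj_on_eq_iff[OF T(3) cs ds(1)])
    moreover have "tensor_inner (tensor cs) (tensor ds) = (if cs = ds then \<Prod>c\<leftarrow>cs. c \<bullet> c else 0)"
      by (rule tensor_inner_basis[OF cs ds(1)])
    ultimately show "tensor_inner (tensor cs) s = (\<Prod>c\<leftarrow>cs. c \<bullet> c) * representation ?T s (tensor cs)"
      by (simp add: ds(2))
  qed
  then show ?thesis using prod by simp
qed

lemma tensor_eqI:
  assumes "\<And>cs. cs \<in> lists basis \<Longrightarrow> tensor_inner (tensor cs) s = tensor_inner (tensor cs) t"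
  shows "s = t"
proof -
  let ?T = "tensor ` lists basis"
  note T = tensor_basis[OF independent_basis span_basis]
  have eq: "representation ?T s v = representation ?T t v" for v
  proof (cases "v \<in> ?T")
    case True
    then obtain cs where "cs \<in> lists basis" "v = tensor cs" by blast
    then show ?thesis using representation_tensor assms by simp
  next
    case False
    then show ?thesis using representation_ne_zero by metis
  qed
  have "s = (\<Sum>v | representation ?T s v \<noteq> 0. representation ?T s v *\<^sub>R v)"
    by (rule sum_nonzero_representation_eq[OF T(1), symmetric]) (simp add: T(2))
  also have "\<dots> = t"
    unfolding eq by (rule sum_nonzero_representation_eq[OF T(1)]) (simp add: T(2))
  finally show ?thesis .
qed

text \<open>The coefficients are the Fourier coefficients of \<open>\<Delta> x\<close>, rewritten by
  adjointness. \<open>Z\<close> is the support, which keeps the sum finite although the basis may be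
  infinite.\<close>

lemma coproduct_expansion:
  obtains Z where "finite Z" "Z \<subseteq> basis \<times> basis"
    and "\<And>w z. w \<in> basis \<Longrightarrow> z \<in> basis \<Longrightarrow> (w * z) \<bullet> x \<noteq> 0 \<Longrightarrow> (w, z) \<in> Z"
    and "\<Delta> x = (\<Sum>(w, z)\<in>Z. (((w * z) \<bullet> x) / ((w \<bullet> w) * (z \<bullet> z))) *\<^sub>R (w \<otimes> z))"
proof -
  let ?T = "tensor ` lists basis"
  note T = tensor_basis[OF independent_basis span_basis]
  let ?r = "representation ?T (\<Delta> x)"
  define Z where "Z = {(w, z). w \<in> basis \<and> z \<in> basis \<and> ?r (w \<otimes> z) \<noteq> 0}"
  have r: "?r (w \<otimes> z) = ((w * z) \<bullet> x) / ((w \<bullet> w) * (z \<bullet> z))" if "w \<in> basis" "z \<in> basis" for w z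
    using representation_tensor[of "[w, z]" "\<Delta> x"] that by (simp add: adjoint)
  have inj: "inj_on (\<lambda>(w, z). w \<otimes> z) Z"
  proof (rule inj_onI, clarify)
    fix w z w' z' assume "(w, z) \<in> Z" "(w', z') \<in> Z" "w \<otimes> z = w' \<otimes> z'"
    then have "[w, z] = [w', z']" by (intro inj_onD[OF T(3)]) (auto simp: Z_def)
    then show "w = w' \<and> z = z'" by simp
  qed
  have r0: "?r t = 0" if "t \<notin> (\<lambda>(w, z). w \<otimes> z) ` Z" for t
  proof (rule ccontr)
    assume nz: "?r t \<noteq> 0"
    obtain cs where cs: "cs \<in> lists basis" "t = tensor cs"
      using representation_ne_zero[OF nz] by blast
    have "tensor_inner (tensor cs) (\<Delta> x) \<noteq> 0"
      using nz unfolding cs(2) representation_tensor[OF cs(1)] by auto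
    \<comment> \<open>A word of length other than two is orthogonal to the second tensor power, in
      which \<open>\<Delta> x\<close> lies.\<close>
    moreover have "tensor_inner (tensor cs) (\<Delta> x) = (\<lambda>_. 0) (\<Delta> x)" if "length cs \<noteq> 2"
      by (rule linear_eq_coproduct[OF linear_tensor_inner(1) linear_zero])
        (use that in \<open>simp add: tensor_inner_tensor\<close>)
    ultimately have "length cs = 2" by blast
    then obtain w z where wz: "cs = [w, z]"
      by (auto simp: numeral_2_eq_2 length_Suc_conv)
    with cs nz have "(w, z) \<in> Z" by (simp add: Z_def)
    from imageI[OF this, of "\<lambda>(w, z). w \<otimes> z"] that show False
      by (simp add: cs(2) wz)
  qed
  have supp: "{t. ?r t \<noteq> 0} = (\<lambda>(w, z). w \<otimes> z) ` Z"
  proof (rule equalityI)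
    show "{t. ?r t \<noteq> 0} \<subseteq> (\<lambda>(w, z). w \<otimes> z) ` Z" using r0 by blast
    show "(\<lambda>(w, z). w \<otimes> z) ` Z \<subseteq> {t. ?r t \<noteq> 0}"
    proof
      fix t assume "t \<in> (\<lambda>(w, z). w \<otimes> z) ` Z"
      then obtain w z where "(w, z) \<in> Z" "t = w \<otimes> z" by (auto simp only:)
      then show "t \<in> {t. ?r t \<noteq> 0}" by (simp add: Z_def)
    qed
  qed
  have "finite Z"
    using finite_representation[of ?T "\<Delta> x"] unfolding supp by (simp add: finite_image_iff[OF inj])
  have "\<Delta> x = (\<Sum>t | ?r t \<noteq> 0. ?r t *\<^sub>R t)"
    using sum_nonzero_representation_eq[OF T(1), of "\<Delta> x"] T(2) by simp
  also have "\<dots> = (\<Sum>(w, z)\<in>Z. ?r (w \<otimes> z) *\<^sub>R (w \<otimes> z))"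
    unfolding supp sum.reindex[OF inj] by (simp add: case_prod_unfold)
  also have "\<dots> = (\<Sum>(w, z)\<in>Z. (((w * z) \<bullet> x) / ((w \<bullet> w) * (z \<bullet> z))) *\<^sub>R (w \<otimes> z))"
  proof (rule sum.cong[OF refl])
    fix p assume "p \<in> Z"
    then obtain w z where p: "p = (w, z)" "w \<in> basis" "z \<in> basis"
      unfolding Z_def by blast
    show "(case p of (w, z) \<Rightarrow> ?r (w \<otimes> z) *\<^sub>R (w \<otimes> z)) =
        (case p of (w, z) \<Rightarrow> (((w * z) \<bullet> x) / ((w \<bullet> w) * (z \<bullet> z))) *\<^sub>R (w \<otimes> z))"
      by (simp only: p(1) case_prod_conv r[OF p(2,3)])
  qed
  finally have "\<Delta> x = (\<Sum>(w, z)\<in>Z. (((w * z) \<bullet> x) / ((w \<bullet> w) * (z \<bullet> z))) *\<^sub>R (w \<otimes> z))" .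
  moreover have "Z \<subseteq> basis \<times> basis" unfolding Z_def by blast
  moreover have "(w, z) \<in> Z" if "w \<in> basis" "z \<in> basis" "(w * z) \<bullet> x \<noteq> 0" for w z
    using that r[OF that(1,2)] inner_basis_pos[OF that(1)] inner_basis_pos[OF that(2)] by (simp add: Z_def)
  ultimately show thesis by (intro that[OF \<open>finite Z\<close>])
qed

section \<open>Self-adjointness, positivity and the rescaling function\<close>

text \<open>One expansion of \<open>\<Delta> x\<close> is read in two ways, paired with
  \<open>u \<otimes> v\<close> and pushed through a bilinear map. The common coefficients are
  nonnegative when \<open>x\<close> is a basis element; this is how positivity spreads to products
  and to Hopf powers.\<close>

lemma product_expansion:
  obtains Z where "finite Z" "Z \<subseteq> basis \<times> basis"
    and "\<And>w z. w \<in> basis \<Longrightarrow> z \<in> basis \<Longrightarrow> (w * z) \<bullet> x \<noteq> 0 \<Longrightarrow> (w, z) \<in> Z"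
    and "\<And>u v. (u * v) \<bullet> x = (\<Sum>(w, z)\<in>Z. (((w * z) \<bullet> x) / ((w \<bullet> w) * (z \<bullet> z))) * ((u \<bullet> w) * (v \<bullet> z)))"
    and "\<And>f :: 'h \<Rightarrow> 'h \<Rightarrow> 'h. bilinear f \<Longrightarrow> tensor2_lift f (\<Delta> x) =
      (\<Sum>(w, z)\<in>Z. (((w * z) \<bullet> x) / ((w \<bullet> w) * (z \<bullet> z))) *\<^sub>R f w z)"
proof -
  obtain Z where Z: "finite Z" "Z \<subseteq> basis \<times> basis"
    "\<And>w z. w \<in> basis \<Longrightarrow> z \<in> basis \<Longrightarrow> (w * z) \<bullet> x \<noteq> 0 \<Longrightarrow> (w, z) \<in> Z"
    "\<Delta> x = (\<Sum>(w, z)\<in>Z. (((w * z) \<bullet> x) / ((w \<bullet> w) * (z \<bullet> z))) *\<^sub>R (w \<otimes> z))"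
    by (rule coproduct_expansion[of x]) blast
  show thesis
  proof (rule that[OF Z(1,2,3)])
    show "(u * v) \<bullet> x = (\<Sum>(w, z)\<in>Z. (((w * z) \<bullet> x) / ((w \<bullet> w) * (z \<bullet> z))) * ((u \<bullet> w) * (v \<bullet> z)))"
      for u v
      unfolding adjoint[of u v] unfolding Z(4) linear_sum[OF linear_tensor_inner(1)]
      by (simp only: case_prod_unfold linear_scale[OF linear_tensor_inner(1)] tensor_inner_tensor)
        simp
    show "tensor2_lift f (\<Delta> x) =
      (\<Sum>(w, z)\<in>Z. (((w * z) \<bullet> x) / ((w \<bullet> w) * (z \<bullet> z))) *\<^sub>R f w z)"
      if "bilinear f" for f :: "'h \<Rightarrow> 'h \<Rightarrow> 'h"
      unfolding Z(4) linear_sum[OF tensor2_lift(1)[OF that]]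
      by (simp only: case_prod_unfold linear_scale[OF tensor2_lift(1)[OF that]] tensor2_lift(2)[OF that])
  qed
qed

text \<open>Iterated adjointness: the recursion that splits off the first factor leaves the tail to
  the induction hypothesis, and \<open>adjoint\<close> joins head and tail again.\<close>

lemma inner_iterated_coproduct:
  "length cs = Suc k \<Longrightarrow>
    tensor_inner (tensor cs) (iterated_coproduct H \<Delta> (Suc k) x) = prod_list cs \<bullet> x"
proof (induction k arbitrary: cs x)
  case 0
  then obtain c where "cs = [c]" by (auto simp: length_Suc_conv)
  then show ?case by (simp add: tensor_inner_tensor)
next
  case (Suc k)
  then obtain c ds where cs: "cs = c # ds" and ds: "length ds = Suc k" by (auto simp: length_Suc_conv)
  have bil: "bilinear (\<lambda>u v. tensor_Cons u (iterated_coproduct H \<Delta> (Suc k) v))"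
    by (rule bilinear_compose[OF bilinear_tensor_Cons linear_id iterated_coproduct_Suc_Suc(1), unfolded id_def])
  have inner_Cons: "tensor_inner (tensor (c # ds)) (tensor_Cons u t) = (c \<bullet> u) * tensor_inner (tensor ds) t"
    for u t
  proof -
    have "tensor_inner (tensor (c # ds)) \<circ> tensor_Cons u = (\<lambda>t. (c \<bullet> u) * t) \<circ> tensor_inner (tensor ds)"
      by (rule tensor_lift_unique)
        (auto intro: linear_compose linear_tensor_inner linear_tensor_Cons linear_times
          simp: tensor_Cons_tensor tensor_inner_tensor_Cons)
    from fun_cong[OF this, of t] show ?thesis by simp
  qed
  have "(tensor_inner (tensor cs) \<circ>
        tensor2_lift (\<lambda>u v. tensor_Cons u (iterated_coproduct H \<Delta> (Suc k) v))) (\<Delta> x) =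
      tensor_inner (c \<otimes> prod_list ds) (\<Delta> x)"
  proof (rule linear_eq_coproduct)
    show "linear (tensor_inner (tensor cs) \<circ>
        tensor2_lift (\<lambda>u v. tensor_Cons u (iterated_coproduct H \<Delta> (Suc k) v)))"
      by (intro linear_compose linear_tensor_inner tensor2_lift(1) bil)
  qed (simp_all add: linear_tensor_inner tensor2_lift(2)[OF bil] cs inner_Cons Suc.IH[OF ds]
      tensor_inner_tensor)
  then show ?case
    by (simp add: iterated_coproduct_Suc_Suc(2) cs del: iterated_coproduct.simps(3) flip: adjoint)
qed

text \<open>The Hopf power is the product after \<open>id \<otimes> hopf_power\<close> after the
  coproduct. The outer maps are adjoint to each other and the middle one is self-adjoint by
  induction, which is checked on pure tensors in both arguments.\<close>

lemma hopf_power_self_adjoint: "hopf_power H \<Delta> (Suc k) x \<bullet> y = x \<bullet> hopf_power H \<Delta> (Suc k) y"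
proof (induction k arbitrary: x y)
  case 0
  then show ?case by (simp add: hopf_power_1)
next
  case (Suc k)
  let ?T = "tensor2_lift (\<lambda>u v. u \<otimes> hopf_power H \<Delta> (Suc k) v)"
  have bil: "bilinear (\<lambda>u v. u \<otimes> hopf_power H \<Delta> (Suc k) v)"
    by (rule bilinear_compose[OF bilinear_tensor2 linear_id linear_hopf_power, unfolded id_def])
  have T: "hopf_power H \<Delta> (Suc (Suc k)) x \<bullet> y = tensor_inner (?T (\<Delta> x)) (\<Delta> y)" for x y
  proof -
    have "((\<lambda>z. z \<bullet> y) \<circ> tensor2_lift (\<lambda>u v. u * hopf_power H \<Delta> (Suc k) v)) (\<Delta> x) =
      ((\<lambda>t. tensor_inner t (\<Delta> y)) \<circ> ?T) (\<Delta> x)"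
    proof (rule linear_eq_coproduct)
      show "linear ((\<lambda>z. z \<bullet> y) \<circ> tensor2_lift (\<lambda>u v. u * hopf_power H \<Delta> (Suc k) v))"
        by (intro linear_compose tensor2_lift(1) bilinear_mult_hopf_power)
          (auto intro!: linearI simp: inner_add_left)
      show "linear ((\<lambda>t. tensor_inner t (\<Delta> y)) \<circ> ?T)"
        by (intro linear_compose tensor2_lift(1) bil linear_tensor_inner)
    qed (simp add: tensor2_lift(2)[OF bil] tensor2_lift(2)[OF bilinear_mult_hopf_power] adjoint)
    then show ?thesis by (simp add: hopf_power_Suc_Suc)
  qed
  have "(\<lambda>s. tensor_inner (?T s) t) (\<Delta> x) = (\<lambda>s. tensor_inner s (?T t)) (\<Delta> x)"
    if "t \<in> tensor_spaces UNIV UNIV" for t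
  proof (rule linear_eq_coproduct)
    show "linear (\<lambda>s. tensor_inner (?T s) t)"
      using linear_compose[OF tensor2_lift(1)[OF bil] linear_tensor_inner(2)] by (simp add: o_def)
    show "linear (\<lambda>s. tensor_inner s (?T t))" by (rule linear_tensor_inner)
    fix u v
    show "tensor_inner (?T (u \<otimes> v)) t = tensor_inner (u \<otimes> v) (?T t)"
    proof (rule linear_eq_on_tensor_spaces[OF _ _ that])
      show "linear (tensor_inner (?T (u \<otimes> v)))" by (rule linear_tensor_inner)
      show "linear (\<lambda>t. tensor_inner (u \<otimes> v) (?T t))"
        using linear_compose[OF tensor2_lift(1)[OF bil] linear_tensor_inner(1)] by (simp add: o_def)
    qed (simp add: tensor2_lift(2)[OF bil] tensor_inner_tensor Suc)
  qed
  from this[OF coproduct_in_tensor_spaces]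
  have "tensor_inner (?T (\<Delta> x)) (\<Delta> y) = tensor_inner (\<Delta> x) (?T (\<Delta> y))" .
  also have "\<dots> = tensor_inner (?T (\<Delta> y)) (\<Delta> x)"
    by (rule tensor_inner_commute)
  finally show ?case
    by (simp add: T inner_commute[of x])
qed

text \<open>For an orthogonal basis the hypotheses mean nonnegative coordinates. They persist under
  multiplication because the structure constants are nonnegative.\<close>

lemma inner_mult_nonneg:
  assumes "\<And>b. b \<in> basis \<Longrightarrow> u \<bullet> b \<ge> 0" "\<And>b. b \<in> basis \<Longrightarrow> v \<bullet> b \<ge> 0" "x \<in> basis"
  shows "(u * v) \<bullet> x \<ge> 0"
proof -
  obtain Z where Z: "Z \<subseteq> basis \<times> basis"
    "\<And>u v. (u * v) \<bullet> x = (\<Sum>(w, z)\<in>Z. (((w * z) \<bullet> x) / ((w \<bullet> w) * (z \<bullet> z))) * ((u \<bullet> w) * (v \<bullet> z)))"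
    by (rule product_expansion[of x]) blast
  show ?thesis
  proof (subst Z(2), rule sum_nonneg, clarify)
    fix w z assume "(w, z) \<in> Z"
    then have "w \<in> basis" "z \<in> basis" using Z(1) by auto
    then show "0 \<le> (((w * z) \<bullet> x) / ((w \<bullet> w) * (z \<bullet> z))) * ((u \<bullet> w) * (v \<bullet> z))"
      by (intro mult_nonneg_nonneg divide_nonneg_nonneg product_coeff_nonneg(2) assms inner_ge_zero)
  qed
qed

lemma hopf_power_nonneg: "x \<in> basis \<Longrightarrow> y \<in> basis \<Longrightarrow> hopf_power H \<Delta> (Suc k) x \<bullet> y \<ge> 0"
proof (induction k arbitrary: x y)
  case 0
  then show ?case using inner_basis[of x y] by (cases "x = y") (simp_all add: hopf_power_1)
next
  case (Suc k)
  obtain Z where Z: "Z \<subseteq> basis \<times> basis"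
    "\<And>f :: 'h \<Rightarrow> 'h \<Rightarrow> 'h. bilinear f \<Longrightarrow> tensor2_lift f (\<Delta> x) =
      (\<Sum>(w, z)\<in>Z. (((w * z) \<bullet> x) / ((w \<bullet> w) * (z \<bullet> z))) *\<^sub>R f w z)"
    by (rule product_expansion[of x]) blast
  show ?case
    unfolding hopf_power_Suc_Suc Z(2)[OF bilinear_mult_hopf_power] inner_sum_left
  proof (rule sum_nonneg, clarify)
    fix w z assume "(w, z) \<in> Z"
    then have wz: "w \<in> basis" "z \<in> basis" using Z(1) by auto
    have "w \<bullet> b \<ge> 0" if "b \<in> basis" for b
      using inner_basis[OF wz(1) that] by (cases "w = b") simp_all
    then have nonneg: "(w * hopf_power H \<Delta> (Suc k) z) \<bullet> y \<ge> 0"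
      using Suc.IH[OF wz(2)] by (intro inner_mult_nonneg Suc.prems)
    have "0 \<le> ((w * z) \<bullet> x) / ((w \<bullet> w) * (z \<bullet> z))"
      by (intro mult_nonneg_nonneg divide_nonneg_nonneg product_coeff_nonneg(2) wz Suc.prems inner_ge_zero)
    from mult_nonneg_nonneg[OF this nonneg]
    show "0 \<le> ((((w * z) \<bullet> x) / ((w \<bullet> w) * (z \<bullet> z))) *\<^sub>R (w * hopf_power H \<Delta> (Suc k) z)) \<bullet> y"
      by (simp only: inner_scaleR_left)
  qed
qed

text \<open>The scaling makes the inner product with each element of \<open>B 1\<close> equal to 1.
  Pairing with the \<open>n\<close>-th power then gives the rescaling function in degree
  \<open>n\<close>.\<close>

definition point_sum :: 'h where "point_sum = (\<Sum>c\<in>B 1. (1 / (c \<bullet> c)) *\<^sub>R c)"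

lemma inner_point_sum:
  assumes "x \<in> basis"
  shows "point_sum \<bullet> x = (if x \<in> B 1 then 1 else 0)"
proof -
  have "point_sum \<bullet> x = (\<Sum>c\<in>B 1. if c = x then 1 else 0)"
    unfolding point_sum_def inner_sum_left
  proof (rule sum.cong[OF refl])
    fix c assume "c \<in> B 1"
    then show "((1 / (c \<bullet> c)) *\<^sub>R c) \<bullet> x = (if c = x then 1 else 0)"
      using inner_basis[of c x] inner_basis_pos[of c] assms by auto
  qed
  then show ?thesis using finite_B[of 1] by simp
qed

lemma inner_point_sum_power_nonneg: "x \<in> basis \<Longrightarrow> point_sum ^ n \<bullet> x \<ge> 0"
proof (induction n arbitrary: x)
  case 0
  have one: "(1::'h) \<in> basis" using B_0 by (intro UN_I[of 0]) auto
  show ?case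
    using inner_basis[OF one 0] by (cases "x = 1") simp_all
next
  case (Suc n)
  show ?case
    unfolding power_Suc
    by (rule inner_mult_nonneg[OF _ Suc.IH Suc.prems]) (simp_all add: inner_point_sum)
qed

lemma point_sum_power_in_H: "point_sum ^ n \<in> H n"
proof (induction n)
  case 0
  then show ?case using one_in_H by simp
next
  case (Suc n)
  have "point_sum \<in> H 1"
    unfolding point_sum_def by (intro subspace_sum subspace_H subspace_scale B_in_H)
  from mult_grading[OF this Suc] show ?case by simp
qed

text \<open>This is where \<open>decomposable\<close> enters. It supplies \<open>w\<close>,
  \<open>z\<close> of lower degrees \<open>i\<close>, \<open>j\<close> with
  \<open>(w * z) \<bullet> x > 0\<close>. In the expansion of
  \<open>point_sum ^ i * point_sum ^ j\<close> against \<open>x\<close> their term is positive by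
  induction, and no term is negative.\<close>

lemma inner_point_sum_power_pos: "x \<in> B n \<Longrightarrow> point_sum ^ n \<bullet> x > 0"
proof (induction n arbitrary: x rule: less_induct)
  case (less n)
  consider "n = 0" | "n = 1" | "n > 1" by linarith
  then show ?case
  proof cases
    case 1
    then show ?thesis using less.prems B_0 by (simp add: inner_one)
  next
    case 2
    have "point_sum \<bullet> x = 1" using 2 less.prems inner_point_sum[of x] by auto
    then show ?thesis using 2 by simp
  next
    case 3
    have x: "x \<in> basis" using less.prems by blast
    obtain i j w z where ij: "i > 0" "j > 0" and w: "w \<in> B i" and z: "z \<in> B j"
      and wz: "product_coeff B [w, z] x \<noteq> 0"
      using decomposable[OF 3 less.prems] by blast
    have basis: "w \<in> basis" "z \<in> basis" using w z by auto
    have nz: "(w * z) \<bullet> x \<noteq> 0" using wz product_coeff_nonneg(1)[OF basis x] by auto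
    then have "i + j = n"
      using inner_H[OF mult_grading[OF B_in_H[OF w] B_in_H[OF z]] B_in_H[OF less.prems]] by blast
    obtain Z where Z: "finite Z" "Z \<subseteq> basis \<times> basis"
      "\<And>w z. w \<in> basis \<Longrightarrow> z \<in> basis \<Longrightarrow> (w * z) \<bullet> x \<noteq> 0 \<Longrightarrow> (w, z) \<in> Z"
      "\<And>u v. (u * v) \<bullet> x = (\<Sum>(w, z)\<in>Z. (((w * z) \<bullet> x) / ((w \<bullet> w) * (z \<bullet> z))) * ((u \<bullet> w) * (v \<bullet> z)))"
      by (rule product_expansion[of x]) blast
    have "(point_sum ^ i * point_sum ^ j) \<bullet> x > 0"
    proof (subst Z(4), rule sum_pos2[OF Z(1) Z(3)[OF basis nz]])
      have "(w * z) \<bullet> x > 0"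
        using nz product_coeff_nonneg(2)[OF basis x] by linarith
      moreover have "point_sum ^ i \<bullet> w > 0" "point_sum ^ j \<bullet> z > 0"
        using less.IH[OF _ w] less.IH[OF _ z] ij \<open>i + j = n\<close> by auto
      ultimately show "0 < (case (w, z) of (w, z) \<Rightarrow>
          (((w * z) \<bullet> x) / ((w \<bullet> w) * (z \<bullet> z))) * ((point_sum ^ i \<bullet> w) * (point_sum ^ j \<bullet> z)))"
        using inner_basis_pos[OF basis(1)] inner_basis_pos[OF basis(2)] by simp
      fix p assume "p \<in> Z"
      then obtain w' z' where p: "p = (w', z')" "w' \<in> basis" "z' \<in> basis" using Z(2) by blast
      show "0 \<le> (case p of (w, z) \<Rightarrow>
          (((w * z) \<bullet> x) / ((w \<bullet> w) * (z \<bullet> z))) * ((point_sum ^ i \<bullet> w) * (point_sum ^ j \<bullet> z)))"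
        unfolding p(1) case_prod_conv
        by (intro mult_nonneg_nonneg divide_nonneg_nonneg product_coeff_nonneg(2) x p
            inner_ge_zero inner_point_sum_power_nonneg)
    qed
    then show ?thesis using \<open>i + j = n\<close> by (simp add: power_add[symmetric])
  qed
qed

lemma point_sum_power:
  "point_sum ^ n = (\<Sum>cs\<in>{cs. set cs \<subseteq> B 1 \<and> length cs = n}. (1 / (\<Prod>c\<leftarrow>cs. c \<bullet> c)) *\<^sub>R prod_list cs)"
proof (induction n)
  case 0
  have "{cs. set cs \<subseteq> B 1 \<and> length cs = 0} = {[]}" by auto
  then show ?case by simp
next
  case (Suc n)
  have inj: "inj_on (\<lambda>(cs, c). c # cs) ({cs. set cs \<subseteq> B 1 \<and> length cs = n} \<times> B 1)"
    by (auto simp: inj_on_def)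
  have "point_sum ^ Suc n = (\<Sum>c\<in>B 1. \<Sum>cs\<in>{cs. set cs \<subseteq> B 1 \<and> length cs = n}.
      ((1 / (c \<bullet> c)) *\<^sub>R c) * ((1 / (\<Prod>c\<leftarrow>cs. c \<bullet> c)) *\<^sub>R prod_list cs))"
    unfolding power_Suc Suc unfolding point_sum_def sum_product ..
  also have "\<dots> = (\<Sum>(cs, c)\<in>{cs. set cs \<subseteq> B 1 \<and> length cs = n} \<times> B 1.
      (1 / (\<Prod>c\<leftarrow>c # cs. c \<bullet> c)) *\<^sub>R prod_list (c # cs))"
    by (subst sum.swap) (simp add: sum.cartesian_product mult.commute)
  also have "\<dots> = (\<Sum>cs\<in>{cs. set cs \<subseteq> B 1 \<and> length cs = Suc n}.
      (1 / (\<Prod>c\<leftarrow>cs. c \<bullet> c)) *\<^sub>R prod_list cs)"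
    unfolding lists_length_Suc_eq sum.reindex[OF inj] by (simp add: case_prod_unfold)
  finally show ?case .
qed

text \<open>The definite description in \<open>counit\<close> is resolved by orthogonality:
  \<open>1\<close> is orthogonal to everything of positive degree.\<close>

lemma counit_one: "counit H 1 = 1"
  unfolding counit_def
proof (rule the_equality)
  show "1 - 1 *\<^sub>R 1 \<in> span (\<Union>n\<in>{1..}. H n)" by (simp add: span_zero)
  fix r assume r: "1 - r *\<^sub>R 1 \<in> span (\<Union>n\<in>{1..}. H n)"
  have "(1::'h) \<bullet> (1 - r *\<^sub>R 1) = 0"
    by (rule inner_eq_0_on_span[of "{1}" _ _, OF _ _ r])
      (use inner_H[OF one_in_H] in \<open>auto intro: span_base\<close>)
  then show "r = 1" by (simp add: inner_diff_right inner_one)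
qed

text \<open>Iterated adjointness turns each coproduct coefficient into the inner product of
  \<open>x\<close> with a scaled product of points. These scaled products are the terms of the
  expanded power of \<open>point_sum\<close>.\<close>

lemma rescaling_eq:
  assumes x: "x \<in> B n"
  shows "rescaling H \<Delta> B n x = point_sum ^ n \<bullet> x"
proof -
  have "coproduct_coeff H \<Delta> B x cs = ((1 / (\<Prod>c\<leftarrow>cs. c \<bullet> c)) *\<^sub>R prod_list cs) \<bullet> x"
    if cs: "set cs \<subseteq> B 1" "length cs = n" for cs
  proof -
    have "tensor_inner (tensor cs) (iterated_coproduct H \<Delta> n x) = prod_list cs \<bullet> x"
    proof (cases n)
      \<comment> \<open>For the empty word \<open>x\<close> is \<open>1\<close>, and the iterated
        coproduct is given by its counit.\<close>
      case 0
      then show ?thesis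
        using cs x B_0 by (simp add: counit_one linear_scale[OF linear_tensor_inner(1)] tensor_inner_tensor inner_one)
    next
      case (Suc k)
      then show ?thesis using inner_iterated_coproduct cs by simp
    qed
    moreover have "cs \<in> lists basis" using cs by auto
    ultimately show ?thesis
      using cs(2) representation_tensor[OF \<open>cs \<in> lists basis\<close>, of "iterated_coproduct H \<Delta> n x"]
      by (simp add: coproduct_coeff_def)
  qed
  then show ?thesis
    by (simp add: rescaling_def point_sum_power inner_sum_left)
qed

lemma rescaling_pos: "x \<in> B n \<Longrightarrow> rescaling H \<Delta> B n x > 0"
  by (simp add: rescaling_eq inner_point_sum_power_pos)

section \<open>Primitive elements\<close>

text \<open>The degree is recorded and required to be positive, so that primitives are orthogonal to
  \<open>1\<close>.\<close>

definition primitive :: "nat \<Rightarrow> 'h \<Rightarrow> bool"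
  where "primitive n u \<longleftrightarrow> n \<ge> 1 \<and> u \<in> H n \<and> \<Delta> u = 1 \<otimes> u + u \<otimes> 1"

text \<open>In degree one the range \<open>{1..<n}\<close> of \<open>coproduct_reduced\<close> is
  empty.\<close>

lemma primitive_degree_one: "u \<in> H 1 \<Longrightarrow> primitive 1 u"
  using coproduct_reduced[of 1 u] by (simp add: primitive_def algebra_simps)

lemma inner_one_primitive: "primitive n u \<Longrightarrow> 1 \<bullet> u = 0" "primitive n u \<Longrightarrow> u \<bullet> 1 = 0"
  using inner_H[OF one_in_H, of u n] by (auto simp: primitive_def inner_commute)

text \<open>Both terms vanish when \<open>x\<close> and \<open>y\<close> are orthogonal to
  \<open>1\<close>. Primitives are thus orthogonal to products of elements of positive
  degree.\<close>

lemma inner_mult_primitive: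
  assumes "primitive n u"
  shows "(x * y) \<bullet> u = (x \<bullet> 1) * (y \<bullet> u) + (x \<bullet> u) * (y \<bullet> 1)"
  using assms
  by (simp add: adjoint primitive_def linear_add[OF linear_tensor_inner(1)] tensor_inner_tensor)

lemma coproduct_primitive_mult:
  "primitive n u \<Longrightarrow> \<Delta> (u * w) = tensor_mult (1 \<otimes> u + u \<otimes> 1) (\<Delta> w)"
  by (simp add: coproduct_mult primitive_def)

lemma tensor_mult_primitive:
  "tensor_mult (1 \<otimes> u + u \<otimes> 1) (x \<otimes> y) = x \<otimes> (u * y) + (u * x) \<otimes> y"
  for u x y :: 'h
  by (simp add: bilinear_ladd[OF bilinear_tensor_mult] tensor_mult_tensor)

lemma linear_tensor_mult: "linear (tensor_mult s)"
  using bilinear_tensor_mult by (auto simp: bilinear_def)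

text \<open>
  The commutator of two primitives is primitive, hence orthogonal to all products of elements of
  positive degree, and so to itself.
\<close>

lemma primitives_commute:
  assumes u: "primitive i u" and v: "primitive j v"
  shows "u * v = v * u"
proof -
  define d where "d = u * v - v * u"
  \<comment> \<open>The mixed terms are symmetric in \<open>u\<close> and \<open>v\<close>, so they
    cancel in the commutator.\<close>
  have uv: "\<Delta> (u * v) = 1 \<otimes> (u * v) + u \<otimes> v + v \<otimes> u + (u * v) \<otimes> 1"
    if u: "primitive i u" and v: "primitive j v" for i j u v
  proof -
    have "\<Delta> v = 1 \<otimes> v + v \<otimes> 1" using v by (simp add: primitive_def)
    then show ?thesis
      unfolding coproduct_primitive_mult[OF u]
      by (simp add: linear_add[OF linear_tensor_mult] tensor_mult_primitive algebra_simps)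
  qed
  have "\<Delta> d = \<Delta> (u * v) - \<Delta> (v * u)"
    by (simp add: d_def linear_diff[OF linear_coproduct])
  also have "\<dots> = 1 \<otimes> d + d \<otimes> 1"
    unfolding uv[OF u v] uv[OF v u]
    by (simp add: d_def bilinear_lsub[OF bilinear_tensor2] bilinear_rsub[OF bilinear_tensor2])
  finally have "primitive (i + j) d"
    using u v mult_grading[of u i v j] mult_grading[of v j u i]
    by (auto simp: primitive_def d_def add.commute intro!: subspace_diff[OF subspace_H])
  then have "(x * y) \<bullet> d = 0" if "primitive k x" "primitive l y" for x y k l
    using inner_mult_primitive[of "i + j" d x y] that by (simp add: inner_one_primitive)
  then have "d \<bullet> d = 0"
    using u v by (simp add: d_def inner_diff_left)
  then show ?thesis by (simp add: d_def)
qed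

text \<open>The first index is the total degree, the second the number of factors, on which the
  Hopf-power eigenvalue depends.\<close>

inductive primitive_product :: "nat \<Rightarrow> nat \<Rightarrow> 'h \<Rightarrow> bool" where
  one: "primitive_product 0 0 1"
| mult: "primitive d u \<Longrightarrow> primitive_product n k w \<Longrightarrow> primitive_product (d + n) (Suc k) (u * w)"

lemma primitive_product_le: "primitive_product n k w \<Longrightarrow> k \<le> n"
  by (induction rule: primitive_product.induct) (auto simp: primitive_def)

lemma primitive_product_mult:
  "primitive_product n k v \<Longrightarrow> primitive_product m l w \<Longrightarrow> primitive_product (n + m) (k + l) (v * w)"
proof (induction rule: primitive_product.induct)
  case (mult d u n k v)
  from primitive_product.mult[OF mult.hyps(1) mult.IH[OF mult.prems]]
  show ?case by (simp add: mult.assoc add.assoc)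
qed simp

text \<open>Every factor has degree at least one, so as many factors as the degree leaves degree
  exactly one for each.\<close>

lemma primitive_product_degree_one:
  "primitive_product n k w \<Longrightarrow> k = n \<Longrightarrow> \<exists>us. set us \<subseteq> H 1 \<and> length us = n \<and> w = prod_list us"
proof (induction rule: primitive_product.induct)
  case one
  show ?case by (intro exI[of _ "[]"]) simp
next
  case (mult d u n k w)
  have "k \<le> n" "d \<ge> 1" using mult.hyps primitive_product_le by (auto simp: primitive_def)
  then have "k = n" "d = 1" using mult.prems by auto
  then obtain us where us: "set us \<subseteq> H 1" "length us = n" "w = prod_list us" using mult.IH by blast
  have "u \<in> H 1" using mult.hyps(1) \<open>d = 1\<close> by (auto simp: primitive_def)
  then show ?case using us \<open>d = 1\<close> by (intro exI[of _ "u # us"]) auto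
qed

text \<open>The reduced coproduct \<open>r\<close> is tested on basis words. On a word
  \<open>[w, z]\<close> with positive degrees summing to \<open>n\<close> the unit terms vanish and
  adjointness gives \<open>(w * z) \<bullet> e = 0\<close>. Every other word is orthogonal to the
  space containing \<open>r\<close>.\<close>

lemma primitive_if_orthogonal_products:
  assumes n: "n \<ge> 1" and e: "e \<in> H n"
    and orth: "\<And>i w z. 1 \<le> i \<Longrightarrow> i < n \<Longrightarrow> w \<in> B i \<Longrightarrow> z \<in> B (n - i) \<Longrightarrow> (w * z) \<bullet> e = 0"
  shows "primitive n e"
proof -
  define r where "r = \<Delta> e - 1 \<otimes> e - e \<otimes> 1"
  have r: "r \<in> span (\<Union>j\<in>{1..<n}. tensor_spaces (H j) (H (n - j)))"
    unfolding r_def by (rule coproduct_reduced[OF n e])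
  have "r = 0"
  proof (rule tensor_eqI)
    fix cs assume cs: "cs \<in> lists basis"
    have "tensor_inner (tensor cs) r = 0"
    proof (cases "\<exists>i w z. 1 \<le> i \<and> i < n \<and> w \<in> B i \<and> z \<in> B (n - i) \<and> cs = [w, z]")
      case True
      then obtain i w z where i: "1 \<le> i" "i < n" and wz: "w \<in> B i" "z \<in> B (n - i)" and cs: "cs = [w, z]"
        by blast
      have "w \<bullet> 1 = 0" "z \<bullet> 1 = 0"
        using inner_H[OF B_in_H[OF wz(1)] one_in_H] inner_H[OF B_in_H[OF wz(2)] one_in_H] i by auto
      then show ?thesis
        using orth[OF i wz]
        by (simp add: r_def cs linear_diff[OF linear_tensor_inner(1)] tensor_inner_tensor flip: adjoint)
    next
      case False
      have "tensor_inner (tensor cs) r \<in> {0}"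
      proof (rule linear_image_tensor_spaces[OF linear_tensor_inner(1) _ r])
        fix k v w assume k: "k \<in> {1..<n}" and v: "v \<in> H k" and w: "w \<in> H (n - k)"
        show "tensor_inner (tensor cs) (v \<otimes> w) \<in> {0}"
        proof (cases "length cs = 2")
          case True
          then obtain b c where bc: "cs = [b, c]" by (auto simp: numeral_2_eq_2 length_Suc_conv)
          then obtain i j where ij: "b \<in> B i" "c \<in> B j" using cs by auto
          then have "i \<noteq> k \<or> j \<noteq> n - k" using False k bc by auto
          then have "b \<bullet> v = 0 \<or> c \<bullet> w = 0"
            using inner_H[OF B_in_H[OF ij(1)] v] inner_H[OF B_in_H[OF ij(2)] w] by blast
          then show ?thesis by (auto simp: bc tensor_inner_tensor)
        qed (simp add: tensor_inner_tensor)
      qed simp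
      then show ?thesis by simp
    qed
    then show "tensor_inner (tensor cs) r = tensor_inner (tensor cs) 0"
      by (simp add: linear_0[OF linear_tensor_inner(1)])
  qed
  then show ?thesis using n e by (simp add: primitive_def r_def algebra_simps)
qed

text \<open>Strong induction on the degree. An element of \<open>H n\<close> is projected onto the
  span of the products \<open>T\<close> of basis elements of lower degree; the remainder is
  orthogonal to them and hence primitive, while \<open>T\<close> is covered by induction.\<close>

lemma span_primitive_products: "H n \<subseteq> span {w. \<exists>k. primitive_product n k w}"
proof (induction n rule: less_induct)
  case (less n)
  let ?P = "\<lambda>n. {w. \<exists>k. primitive_product n k w}"
  show ?case
  proof (cases "n = 0")
    case True
    have "1 \<in> ?P 0" using primitive_product.one by blast
    then show ?thesis unfolding True connected by (auto intro: span_scale span_base)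
  next
    case False
    define T where "T = (\<Union>i\<in>{1..<n}. \<Union>w\<in>B i. (\<lambda>z. w * z) ` B (n - i))"
    have "finite T" unfolding T_def using finite_B by blast
    have "T \<subseteq> H n"
    proof
      fix t assume "t \<in> T"
      then obtain i w z where "i \<in> {1..<n}" "w \<in> B i" "z \<in> B (n - i)" "t = w * z" unfolding T_def by blast
      then show "t \<in> H n" using mult_grading[OF B_in_H B_in_H, of w i z "n - i"] by simp
    qed
    have "T \<subseteq> span (?P n)"
    proof
      fix t assume "t \<in> T"
      then obtain i w z where i: "i \<in> {1..<n}" and wz: "w \<in> B i" "z \<in> B (n - i)" and t: "t = w * z"
        unfolding T_def by blast
      have w: "w \<in> span (?P i)" and z: "z \<in> span (?P (n - i))"
        using less.IH[of i] less.IH[of "n - i"] i B_in_H[OF wz(1)] B_in_H[OF wz(2)] by auto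
      \<comment> \<open>\<open>primitive_product_mult\<close> is extended to spans one factor at a
        time, first on the right and then on the left.\<close>
      have "a * z \<in> span (?P n)" if a: "a \<in> ?P i" for a
      proof -
        have "(*) a ` ?P (n - i) \<subseteq> ?P n"
          using a i primitive_product_mult[of i _ a "n - i"] by fastforce
        moreover have "a * z \<in> span ((*) a ` ?P (n - i))"
          using z linear_span_image[of "(*) a" "?P (n - i)"]
          by (auto intro!: linearI simp: distrib_left)
        ultimately show ?thesis using span_mono by blast
      qed
      then have "span ((\<lambda>a. a * z) ` ?P i) \<subseteq> span (?P n)" by (intro span_minimal) auto
      moreover have "linear (\<lambda>a. a * z)" by (auto intro!: linearI simp: distrib_right)
      from linear_span_image[OF this, of "?P i"]
      have "w * z \<in> span ((\<lambda>a. a * z) ` ?P i)" using w by blast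
      ultimately show "t \<in> span (?P n)" using t by blast
    qed
    show ?thesis
    proof
      fix x assume x: "x \<in> H n"
      obtain d where d: "d \<in> span T" and orth: "\<And>t. t \<in> span T \<Longrightarrow> t \<bullet> (x - d) = 0"
        using orthogonal_projection_exists[OF \<open>finite T\<close>] by blast
      have "d \<in> H n" using d span_minimal[OF \<open>T \<subseteq> H n\<close> subspace_H] by blast
      have "primitive n (x - d)"
      proof (rule primitive_if_orthogonal_products)
        show "n \<ge> 1" using False by simp
        show "x - d \<in> H n" by (rule subspace_diff[OF subspace_H x \<open>d \<in> H n\<close>])
        show "(w * z) \<bullet> (x - d) = 0" if "1 \<le> i" "i < n" "w \<in> B i" "z \<in> B (n - i)" for i w z
          by (rule orth, rule span_base, unfold T_def, intro UN_I imageI) (use that in auto)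
      qed
      from primitive_product.mult[OF this primitive_product.one]
      have "x - d \<in> span (?P n)" by (intro span_base) auto
      moreover have "d \<in> span (?P n)"
        using d span_minimal[OF \<open>T \<subseteq> span (?P n)\<close> subspace_span] by blast
      ultimately show "x \<in> span (?P n)" using span_add[of "x - d" _ d] by simp
    qed
  qed
qed

text \<open>Primitives commute with each other, hence with products of primitives, and these span
  the whole algebra.\<close>

lemma primitive_central:
  assumes u: "primitive d u"
  shows "u * x = x * u"
proof (rule linear_eq_on[of "(*) u" "\<lambda>x. x * u" x "{w. \<exists>n k. primitive_product n k w}"])
  show "linear ((*) u)" "linear (\<lambda>x. x * u)"
    by (auto intro!: linearI simp: distrib_left distrib_right)
  have "H n \<subseteq> span {w. \<exists>n k. primitive_product n k w}" for n
    by (rule order_trans[OF span_primitive_products]) (auto intro!: span_mono)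
  then have "span (\<Union>n. H n) \<subseteq> span {w. \<exists>n k. primitive_product n k w}"
    by (intro span_minimal) auto
  then show "x \<in> span {w. \<exists>n k. primitive_product n k w}" by (auto simp: span_H)
  fix w assume "w \<in> {w. \<exists>n k. primitive_product n k w}"
  then obtain n k where "primitive_product n k w" by blast
  then show "u * w = w * u"
  proof (induction rule: primitive_product.induct)
    case (mult d' v n k w)
    have "u * (v * w) = v * (u * w)"
      using primitives_commute[OF u mult.hyps(1)] by (metis mult.assoc)
    then show ?case using mult.IH by (simp add: mult.assoc)
  qed simp
qed

section \<open>Eigenvectors of the Hopf powers\<close>

text \<open>The coproduct of \<open>u * w\<close> is \<open>(1 \<otimes> u + u \<otimes> 1)\<close>
  times \<open>\<Delta> w\<close>. In the convolution \<open>u \<otimes> 1\<close> contributes one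
  copy of \<open>u * hopf_power\<close> and \<open>1 \<otimes> u\<close> contributes
  \<open>Suc k\<close> copies by induction, once centrality has moved \<open>u\<close> to the
  front.\<close>

lemma hopf_power_primitive_mult:
  assumes u: "primitive d u"
  shows "hopf_power H \<Delta> (Suc k) (u * w) = real (Suc k) *\<^sub>R (u * hopf_power H \<Delta> (Suc k) w)"
proof (induction k arbitrary: w)
  case 0
  then show ?case by (simp add: hopf_power_1)
next
  case (Suc k)
  let ?L = "tensor2_lift (\<lambda>u v. u * hopf_power H \<Delta> (Suc k) v)"
  note L = tensor2_lift[OF bilinear_mult_hopf_power, of k]
  have "(?L \<circ> tensor_mult (1 \<otimes> u + u \<otimes> 1)) (\<Delta> w) =
      ((\<lambda>x. real (Suc (Suc k)) *\<^sub>R (u * x)) \<circ> ?L) (\<Delta> w)"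
  proof (rule linear_eq_coproduct)
    show "linear (?L \<circ> tensor_mult (1 \<otimes> u + u \<otimes> 1))"
      by (intro linear_compose linear_tensor_mult L)
    show "linear ((\<lambda>x. real (Suc (Suc k)) *\<^sub>R (u * x)) \<circ> ?L)"
      by (intro linear_compose L) (auto intro!: linearI simp: algebra_simps)
    fix x y
    have "(?L \<circ> tensor_mult (1 \<otimes> u + u \<otimes> 1)) (x \<otimes> y) =
        x * hopf_power H \<Delta> (Suc k) (u * y) + u * x * hopf_power H \<Delta> (Suc k) y"
      by (simp add: tensor_mult_primitive linear_add[OF L(1)] L(2))
    also have "x * hopf_power H \<Delta> (Suc k) (u * y) = real (Suc k) *\<^sub>R (u * x * hopf_power H \<Delta> (Suc k) y)"
      by (simp add: Suc primitive_central[OF u, of x] mult.assoc)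
    finally show "(?L \<circ> tensor_mult (1 \<otimes> u + u \<otimes> 1)) (x \<otimes> y) =
        ((\<lambda>x. real (Suc (Suc k)) *\<^sub>R (u * x)) \<circ> ?L) (x \<otimes> y)"
      by (simp add: L(2) algebra_simps scaleR_2)
  qed
  then show ?case
    by (simp add: hopf_power_Suc_Suc coproduct_primitive_mult[OF u])
qed

lemma hopf_power_one: "hopf_power H \<Delta> (Suc k) 1 = 1"
  by (induction k)
    (simp_all add: hopf_power_1 hopf_power_Suc_Suc coproduct_one tensor2_lift(2)[OF bilinear_mult_hopf_power])

lemma hopf_power_primitive_product:
  "primitive_product n l w \<Longrightarrow> hopf_power H \<Delta> (Suc k) w = real (Suc k) ^ l *\<^sub>R w"
  by (induction rule: primitive_product.induct)
    (simp_all add: hopf_power_one hopf_power_primitive_mult)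

text \<open>A creation and annihilation argument. With \<open>D\<close> as below, the squared norm
  of \<open>u * w\<close> is the squared norm of \<open>D (\<Delta> w)\<close> plus
  \<open>(u \<bullet> u) * (w \<bullet> w)\<close>.\<close>

lemma inner_primitive_mult:
  assumes u: "primitive d u"
  shows "(u * w) \<bullet> (u * w) \<ge> (u \<bullet> u) * (w \<bullet> w)"
proof -
  \<comment> \<open>\<open>D\<close> contracts the first factor with \<open>u\<close>, so that
    \<open>D\<close> after \<open>\<Delta>\<close> is adjoint to left multiplication by
    \<open>u\<close>.\<close>
  define D where "D = tensor2_lift (\<lambda>x y. (u \<bullet> x) *\<^sub>R y)"
  have bil: "bilinear (\<lambda>x y. (u \<bullet> x) *\<^sub>R y)"
    by (auto simp: bilinear_def inner_add_right algebra_simps intro!: linearI)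
  note D = tensor2_lift[OF bil, folded D_def]
  have "(tensor_inner (u \<otimes> w) \<circ> tensor_mult (1 \<otimes> u + u \<otimes> 1)) (\<Delta> w) =
      (\<lambda>t. w \<bullet> (u * D t) + (u \<bullet> u) * tensor_inner (1 \<otimes> w) t) (\<Delta> w)"
  proof (rule linear_eq_coproduct)
    show "linear (tensor_inner (u \<otimes> w) \<circ> tensor_mult (1 \<otimes> u + u \<otimes> 1))"
      by (intro linear_compose linear_tensor_mult linear_tensor_inner)
    show "linear (\<lambda>t. w \<bullet> (u * D t) + (u \<bullet> u) * tensor_inner (1 \<otimes> w) t)"
      by (rule linearI)
        (simp_all add: linear_add[OF D(1)] linear_scale[OF D(1)] linear_add[OF linear_tensor_inner(1)]
          linear_scale[OF linear_tensor_inner(1)] algebra_simps inner_add_right)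
    fix x y
    have "u \<bullet> (u * x) = (u \<bullet> u) * (1 \<bullet> x)"
      using inner_mult_primitive[OF u, of u x] inner_one_primitive[OF u]
      by (simp add: inner_commute)
    then show "(tensor_inner (u \<otimes> w) \<circ> tensor_mult (1 \<otimes> u + u \<otimes> 1)) (x \<otimes> y) =
        w \<bullet> (u * D (x \<otimes> y)) + (u \<bullet> u) * tensor_inner (1 \<otimes> w) (x \<otimes> y)"
      by (simp add: tensor_mult_primitive linear_add[OF linear_tensor_inner(1)] tensor_inner_tensor D(2))
  qed
  \<comment> \<open>Adjointness of \<open>D\<close> is applied to the vector
    \<open>D (\<Delta> w)\<close> itself, which turns the first term into a squared norm.\<close>
  moreover have "tensor_inner (u \<otimes> D (\<Delta> w)) (\<Delta> w) = (\<lambda>t. D (\<Delta> w) \<bullet> D t) (\<Delta> w)"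
  proof (rule linear_eq_coproduct[where F = "tensor_inner (u \<otimes> D (\<Delta> w))"
        and G = "\<lambda>t. D (\<Delta> w) \<bullet> D t"])
    show "linear (\<lambda>t. D (\<Delta> w) \<bullet> D t)"
      by (rule linearI) (simp_all add: linear_add[OF D(1)] linear_scale[OF D(1)] inner_add_right)
  qed (simp_all add: linear_tensor_inner tensor_inner_tensor D(2))
  then have "w \<bullet> (u * D (\<Delta> w)) = D (\<Delta> w) \<bullet> D (\<Delta> w)"
    by (simp add: inner_commute[of w] flip: adjoint)
  ultimately show ?thesis
    using adjoint[of 1 w w]
    by (simp add: adjoint[of u w] coproduct_primitive_mult[OF u])
qed

text \<open>The norm bound is iterated over the factors. The lemma later guarantees that the state
  space is non-empty.\<close>

lemma prod_primitives_nonzero: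
  "set us \<subseteq> H 1 \<Longrightarrow> 0 \<notin> set us \<Longrightarrow> prod_list us \<noteq> 0"
proof (induction us)
  case (Cons u us)
  then have "primitive 1 u" by (intro primitive_degree_one) simp
  from inner_primitive_mult[OF this, of "prod_list us"]
  have "(u * prod_list us) \<bullet> (u * prod_list us) \<ge> (u \<bullet> u) * (prod_list us \<bullet> prod_list us)" .
  moreover have "(u \<bullet> u) * (prod_list us \<bullet> prod_list us) > 0" using Cons by auto
  ultimately show ?case by auto
qed simp

lemma hopf_power_point_sum: "hopf_power H \<Delta> (Suc k) (point_sum ^ n) = real (Suc k) ^ n *\<^sub>R point_sum ^ n"
proof (induction n)
  case 0
  then show ?case by (simp add: hopf_power_one)
next
  case (Suc n)
  have "primitive 1 point_sum"
    using primitive_degree_one point_sum_power_in_H[of 1] by simp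
  from hopf_power_primitive_mult[OF this] Suc show ?case by simp
qed

text \<open>Multilinear extension from \<open>B 1\<close> to its span, letter by letter: in the
  induction \<open>vs\<close> collects the leading letters, which are basis elements.\<close>

lemma inner_prod_list_eq_0:
  assumes "\<And>us. set us \<subseteq> B 1 \<Longrightarrow> length us = n \<Longrightarrow> g \<bullet> prod_list us = 0"
    and "set us \<subseteq> H 1" "length us = n"
  shows "g \<bullet> prod_list us = 0"
proof -
  have "g \<bullet> prod_list (vs @ us) = 0"
    if "set vs \<subseteq> B 1" "set us \<subseteq> H 1" "length vs + length us = n" for vs us
    using that
  proof (induction us arbitrary: vs)
    case Nil
    then show ?case using assms(1) by simp
  next
    case (Cons u us)
    have "linear (\<lambda>x. g \<bullet> prod_list (vs @ x # us))"
      by (rule linearI) (simp_all add: inner_add_right algebra_simps)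
    moreover have "g \<bullet> prod_list (vs @ x # us) = 0" if "x \<in> B 1" for x
      using Cons.IH[of "vs @ [x]"] Cons.prems that by simp
    moreover have "u \<in> span (B 1)" using Cons.prems span_B by simp
    ultimately show ?case by (rule linear_eq_0_on_span)
  qed
  from this[of "[]" us] assms show ?thesis by simp
qed

text \<open>
  Products of fewer than \<open>n\<close> primitives lie in other eigenspaces of the self-adjoint Hopf power, so
  \<open>g\<close> is automatically orthogonal to them.
\<close>

lemma eigenvector_eq_0:
  assumes k: "k \<ge> 1" and g: "g \<in> H n"
    and eigen: "hopf_power H \<Delta> (Suc k) g = real (Suc k) ^ n *\<^sub>R g"
    and orth: "\<And>us. set us \<subseteq> B 1 \<Longrightarrow> length us = n \<Longrightarrow> g \<bullet> prod_list us = 0"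
  shows "g = 0"
proof -
  have "g \<bullet> w = 0" if w: "primitive_product n l w" for l w
  proof (cases "l = n")
    case True
    then show ?thesis using primitive_product_degree_one[OF w] inner_prod_list_eq_0[OF orth] by blast
  next
    case False
    have "real (Suc k) ^ n * (g \<bullet> w) = real (Suc k) ^ l * (g \<bullet> w)"
      using hopf_power_self_adjoint[of k g w] by (simp add: eigen hopf_power_primitive_product[OF w])
    moreover have "real (Suc k) ^ n \<noteq> real (Suc k) ^ l"
      using False k power_inject_exp[of "real (Suc k)" n l] by simp
    ultimately show ?thesis by simp
  qed
  then have "g \<bullet> g = 0"
    using inner_eq_0_on_span[of "{g}" "{w. \<exists>l. primitive_product n l w}" g g] g
      span_primitive_products[of n] by (auto intro: span_base)
  then show ?thesis by simp
qed

section \<open>Reversibility\<close>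

text \<open>A common form for \<open>B n\<close> and \<open>C \<nu>\<close>. The vector
  \<open>q\<close> stands for the only \<open>n\<close>-fold product of elements of
  \<open>B 1\<close> that can fail to be orthogonal to \<open>S\<close>.\<close>

lemma reversible_chain_hopf_power:
  assumes a: "a \<ge> 2" and S: "S \<subseteq> B n" and q: "q \<in> span S" "q \<noteq> 0"
    and closed: "\<And>x. x \<in> S \<Longrightarrow> hopf_power H \<Delta> a x \<in> span S"
    and prods: "\<And>us x. set us \<subseteq> B 1 \<Longrightarrow> length us = n \<Longrightarrow> x \<in> S \<Longrightarrow>
      prod_list us = q \<or> prod_list us \<bullet> x = 0"
  shows "reversible_chain S (hopf_power_matrix H \<Delta> B a n)"
proof -
  obtain k where k: "a = Suc k" "k \<ge> 1" using a by (cases a) auto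
  let ?\<Psi> = "hopf_power H \<Delta> a"
  let ?K = "hopf_power_matrix H \<Delta> B a n"
  define \<eta> where "\<eta> = rescaling H \<Delta> B n"
  have finS: "finite S" using S finite_B finite_subset by blast
  have basis: "x \<in> basis" if "x \<in> S" for x using that S by blast
  have orthB: "pairwise orthogonal (B n)"
    by (rule pairwise_subset[OF orthogonal_basis]) blast
  have orthS: "pairwise orthogonal S" by (rule pairwise_subset[OF orthB S])
  have indS: "independent S" using independent_B independent_mono S by blast
  have \<eta>: "\<eta> x > 0" "\<eta> x = point_sum ^ n \<bullet> x" if "x \<in> S" for x
    using rescaling_pos[of x n] rescaling_eq[of x n] S that by (auto simp: \<eta>_def)
  have norm: "x \<bullet> x > 0" if "x \<in> S" for x by (rule inner_basis_pos[OF basis[OF that]])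
  have apos: "real a ^ n > 0" using a by simp
  have linP: "linear ?\<Psi>" unfolding k(1) by (rule linear_hopf_power)
  have sym: "?\<Psi> x \<bullet> y = x \<bullet> ?\<Psi> y" for x y
    unfolding k(1) by (rule hopf_power_self_adjoint)
  have expand: "v = (\<Sum>y\<in>S. ((v \<bullet> y) / (y \<bullet> y)) *\<^sub>R y)" if "v \<in> span S" for v
    by (rule orthogonal_expansion[OF orthS indS finS that])
  have K: "?K x y = \<eta> y / \<eta> x * ((?\<Psi> x \<bullet> y) / (y \<bullet> y)) / real a ^ n" if "x \<in> S" "y \<in> S" for x y
  proof -
    have "?\<Psi> x \<in> span (B n)" using closed[OF that(1)] span_mono[OF S] by blast
    then have "representation (B n) ((1 / real a ^ n) *\<^sub>R ?\<Psi> x) y =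
        (((1 / real a ^ n) *\<^sub>R ?\<Psi> x) \<bullet> y) / (y \<bullet> y)"
      using that(2) S by (intro representation_orthogonal orthB independent_B span_scale) auto
    then show ?thesis by (simp add: hopf_power_matrix_def \<eta>_def)
  qed
  have K_nonneg: "?K x y \<ge> 0" if "x \<in> S" "y \<in> S" for x y
  proof -
    have "?\<Psi> x \<bullet> y \<ge> 0" unfolding k(1) by (intro hopf_power_nonneg basis that)
    then show ?thesis
      unfolding K[OF that]
      by (intro mult_nonneg_nonneg divide_nonneg_nonneg less_imp_le[OF \<eta>(1)] less_imp_le[OF norm]
          less_imp_le[OF apos] that)
  qed
  \<comment> \<open>The factor \<open>\<eta> y\<close> in \<open>?K x y\<close> is
    \<open>point_sum ^ n \<bullet> y\<close>, so the sum reassembles the inner product of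
    \<open>point_sum ^ n\<close> with \<open>?\<Psi> x\<close>.\<close>
  have row_sum: "(\<Sum>y\<in>S. ?K x y) = 1" if x: "x \<in> S" for x
  proof -
    have "(\<Sum>y\<in>S. ?K x y) = (\<Sum>y\<in>S. point_sum ^ n \<bullet> (((?\<Psi> x \<bullet> y) / (y \<bullet> y)) *\<^sub>R y)) / (\<eta> x * real a ^ n)"
      unfolding sum_divide_distrib by (rule sum.cong) (simp_all add: K[OF x] \<eta>(2) mult_ac)
    also have "\<dots> = (point_sum ^ n \<bullet> ?\<Psi> x) / (\<eta> x * real a ^ n)"
      unfolding inner_sum_right[symmetric] expand[OF closed[OF x], symmetric] ..
    also have "point_sum ^ n \<bullet> ?\<Psi> x = real a ^ n * \<eta> x"
      unfolding sym[symmetric] by (simp add: k(1) hopf_power_point_sum \<eta>(2)[OF x])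
    finally show ?thesis using \<eta>(1)[OF x] apos by simp
  qed
  \<comment> \<open>This weight cancels the asymmetric factors \<open>1 / \<eta> x\<close> and
    \<open>1 / (y \<bullet> y)\<close> of \<open>?K x y\<close> up to an expression symmetric in
    \<open>x\<close> and \<open>y\<close>.\<close>
  define W where "W x = \<eta> x ^ 2 / (x \<bullet> x)" for x
  have W: "W x > 0" if "x \<in> S" for x
    using \<eta>(1)[OF that] norm[OF that] by (simp add: W_def)
  have balance: "W x * ?K x y = W y * ?K y x" if "x \<in> S" "y \<in> S" for x y
  proof -
    have "?\<Psi> y \<bullet> x = ?\<Psi> x \<bullet> y" using sym[of y x] by (simp add: inner_commute)
    moreover have "W x * ?K x y = \<eta> x * \<eta> y * (?\<Psi> x \<bullet> y) / ((x \<bullet> x) * (y \<bullet> y) * real a ^ n)"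
      if "x \<in> S" "y \<in> S" for x y
      using \<eta>(1)[OF that(1)] by (simp add: W_def K[OF that] power2_eq_square)
    ultimately show ?thesis using that by (simp add: mult_ac)
  qed
  \<comment> \<open>A non-zero vector in the span rules out an empty state space.\<close>
  have "S \<noteq> {}" using q by auto
  define Z where "Z = (\<Sum>x\<in>S. W x)"
  have Z: "Z > 0" unfolding Z_def by (rule sum_pos[OF finS \<open>S \<noteq> {}\<close> W])
  define p where "p x = W x / Z" for x
  have p_pos: "p x > 0" if "x \<in> S" for x using W[OF that] Z by (simp add: p_def)
  have p_balance: "p x * ?K x y = p y * ?K y x" if "x \<in> S" "y \<in> S" for x y
    using balance[OF that] by (simp add: p_def)
  have p_stat: "stationary_distribution S ?K p"
    unfolding stationary_distribution_def
  proof (intro conjI ballI)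
    show "p x \<ge> 0" if "x \<in> S" for x using p_pos[OF that] by simp
    show "(\<Sum>x\<in>S. p x) = 1" using Z by (simp add: p_def Z_def flip: sum_divide_distrib)
    fix y assume y: "y \<in> S"
    have "(\<Sum>x\<in>S. p x * ?K x y) = (\<Sum>x\<in>S. p y * ?K y x)"
      by (rule sum.cong) (simp_all add: p_balance y)
    also have "\<dots> = p y" by (simp add: row_sum[OF y] flip: sum_distrib_left)
    finally show "(\<Sum>x\<in>S. p x * ?K x y) = p y" .
  qed
  \<comment> \<open>Dividing by \<open>\<eta>\<close> undoes the rescaling in \<open>?K\<close>, so
    that stationarity of a row vector becomes an eigenvector equation for
    \<open>?\<Psi>\<close>.\<close>
  define g where "g f = (\<Sum>x\<in>S. (f x / \<eta> x) *\<^sub>R x)" for f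
  have g_span: "g f \<in> span S" for f
    unfolding g_def by (intro span_sum span_scale span_base)
  have g_inner: "g f \<bullet> x = f x / \<eta> x * (x \<bullet> x)" if x: "x \<in> S" for f x
  proof -
    have "g f \<bullet> x = (\<Sum>z\<in>S. if z = x then f x / \<eta> x * (x \<bullet> x) else 0)"
      unfolding g_def inner_sum_left using orthS x
      by (intro sum.cong) (auto simp: pairwise_def orthogonal_def)
    then show ?thesis using finS x by simp
  qed
  have g_eigen: "?\<Psi> (g f) = real a ^ n *\<^sub>R g f" if f: "stationary_distribution S ?K f" for f
  proof -
    have "?\<Psi> (g f) = (\<Sum>x\<in>S. (f x / \<eta> x) *\<^sub>R ?\<Psi> x)"
      by (simp add: g_def linear_sum[OF linP] linear_scale[OF linP])
    also have "\<dots> = (\<Sum>x\<in>S. (f x / \<eta> x) *\<^sub>R (\<Sum>y\<in>S. ((?\<Psi> x \<bullet> y) / (y \<bullet> y)) *\<^sub>R y))"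
      by (rule sum.cong) (simp_all add: expand[OF closed, symmetric])
    also have "\<dots> = (\<Sum>x\<in>S. \<Sum>y\<in>S. (real a ^ n * (f x * ?K x y) / \<eta> y) *\<^sub>R y)"
      unfolding scaleR_sum_right
    proof (intro sum.cong refl)
      fix x y assume "x \<in> S" "y \<in> S"
      then show "(f x / \<eta> x) *\<^sub>R ((?\<Psi> x \<bullet> y) / (y \<bullet> y)) *\<^sub>R y = (real a ^ n * (f x * ?K x y) / \<eta> y) *\<^sub>R y"
        using \<eta>(1)[of x] \<eta>(1)[of y] apos by (simp add: K)
    qed
    also have "\<dots> = (\<Sum>y\<in>S. (real a ^ n * (\<Sum>x\<in>S. f x * ?K x y) / \<eta> y) *\<^sub>R y)"
      by (subst sum.swap) (simp add: sum_distrib_left sum_divide_distrib scaleR_sum_left)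
    also have "\<dots> = (\<Sum>y\<in>S. (real a ^ n * f y / \<eta> y) *\<^sub>R y)"
      by (rule sum.cong) (use f in \<open>simp_all add: stationary_distribution_def\<close>)
    also have "\<dots> = real a ^ n *\<^sub>R g f"
      by (simp add: g_def scaleR_sum_right)
    finally show ?thesis .
  qed
  \<comment> \<open>Products other than \<open>q\<close> are orthogonal to \<open>S\<close> by
    \<open>prods\<close>, so the single condition \<open>h \<bullet> q = 0\<close> supplies all the
    orthogonality that \<open>eigenvector_eq_0\<close> asks for.\<close>
  have zero: "h = 0" if h: "h \<in> span S" "?\<Psi> h = real a ^ n *\<^sub>R h" "h \<bullet> q = 0" for h
  proof (rule eigenvector_eq_0[OF k(2)])
    show "h \<in> H n" using h(1) span_mono[OF S] span_B by blast
    show "hopf_power H \<Delta> (Suc k) h = real (Suc k) ^ n *\<^sub>R h" using h(2) by (simp add: k(1))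
    fix us assume us: "set us \<subseteq> B 1" "length us = n"
    show "h \<bullet> prod_list us = 0"
    proof (cases "prod_list us = q")
      case True
      then show ?thesis using h(3) by simp
    next
      case False
      then show ?thesis
        using prods[OF us] inner_eq_0_on_span[of S "{prod_list us}" h "prod_list us"] h(1)
        by (auto simp: span_base inner_commute)
    qed
  qed
  obtain x0 where x0: "x0 \<in> S" using \<open>S \<noteq> {}\<close> by blast
  have nz: "g p \<bullet> q \<noteq> 0"
  proof
    assume "g p \<bullet> q = 0"
    from zero[OF g_span g_eigen[OF p_stat] this] have "g p \<bullet> x0 = 0" by simp
    then show False using g_inner[OF x0, of p] p_pos[OF x0] \<eta>(1)[OF x0] norm[OF x0] by simp
  qed
  have unique: "f x = p x" if f: "stationary_distribution S ?K f" and x: "x \<in> S" for f x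
  proof -
    \<comment> \<open>This combination is orthogonal to \<open>q\<close> and therefore vanishes.
      Hence \<open>f\<close> and \<open>p\<close> are proportional, and total mass 1 fixes the
      factor.\<close>
    define h where "h = (g p \<bullet> q) *\<^sub>R g f - (g f \<bullet> q) *\<^sub>R g p"
    have "h = 0"
    proof (rule zero)
      show "h \<in> span S" unfolding h_def by (intro span_diff span_scale g_span)
      show "?\<Psi> h = real a ^ n *\<^sub>R h"
        by (simp add: h_def linear_diff[OF linP] linear_scale[OF linP] g_eigen[OF f]
            g_eigen[OF p_stat] scaleR_diff_right mult.commute)
    qed (simp add: h_def inner_diff_left)
    have ratio: "(g p \<bullet> q) * f y = (g f \<bullet> q) * p y" if y: "y \<in> S" for y
    proof -
      have "((g p \<bullet> q) * f y - (g f \<bullet> q) * p y) * ((y \<bullet> y) / \<eta> y) = h \<bullet> y"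
        by (simp add: h_def inner_diff_left g_inner[OF y] algebra_simps diff_divide_distrib)
      then show ?thesis using \<open>h = 0\<close> norm[OF y] \<eta>(1)[OF y] by auto
    qed
    have "(g p \<bullet> q) * (\<Sum>y\<in>S. f y) = (g f \<bullet> q) * (\<Sum>y\<in>S. p y)"
      unfolding sum_distrib_left by (rule sum.cong) (simp_all add: ratio)
    then have "g p \<bullet> q = g f \<bullet> q"
      using f p_stat by (simp add: stationary_distribution_def)
    then show ?thesis using ratio[OF x] nz by simp
  qed
  show ?thesis
    unfolding reversible_chain_def transition_matrix_def
    using finS K_nonneg row_sum p_stat unique p_pos p_balance by blast
qed

section \<open>The state spaces of a single-point algebra and of a multigraded algebra\<close>

lemma hopf_power_in_H: "x \<in> H n \<Longrightarrow> hopf_power H \<Delta> (Suc k) x \<in> H n"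
proof (rule hopf_power_in_graded_piece[of H, OF subspace_H mult_grading])
  fix n x assume "x \<in> H n"
  from coproduct_grading[OF this]
  show "\<Delta> x \<in> span (\<Union>(i, j)\<in>{(i, j). i + j = n}. tensor_spaces (H i) (H j))"
    by (rule rev_subsetD[OF _ span_mono]) force
qed

lemma reversible_chain_one_point:
  assumes a: "a \<ge> 2" and b: "B 1 = {b}"
  shows "reversible_chain (B n) (hopf_power_matrix H \<Delta> B a n)"
proof (rule reversible_chain_hopf_power[OF a subset_refl])
  have b': "b \<in> H 1" "b \<noteq> 0" using b B_in_H[of b 1] basis_nonzero[of b] by auto
  have prod: "prod_list us = b ^ n" if "set us \<subseteq> B 1" "length us = n" for us
  proof -
    have "us = replicate n b" using that b by (intro replicate_eqI) auto
    then show ?thesis by simp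
  qed
  have "b ^ n \<in> H n"
  proof (induction n)
    case (Suc n)
    from mult_grading[OF b'(1) this] show ?case by simp
  qed (simp add: one_in_H)
  then show "b ^ n \<in> span (B n)" by (simp add: span_B)
  show "b ^ n \<noteq> 0"
    using prod_primitives_nonzero[of "replicate n b"] b' by (simp add: subset_eq)
  obtain k where "a = Suc k" using a by (cases a) auto
  then show "hopf_power H \<Delta> a x \<in> span (B n)" if "x \<in> B n" for x
    using hopf_power_in_H[OF B_in_H[OF that]] by (simp add: span_B)
  show "prod_list us = b ^ n \<or> prod_list us \<bullet> x = 0"
    if "set us \<subseteq> B 1" "length us = n" "x \<in> B n" for us x
    using prod that by blast
qed

text \<open>Degree-one elements are primitive, hence central. A product of the points is thus
  determined by its multidegree.\<close>

lemma prod_list_primitives_cong: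
  assumes "mset us = mset vs" "set us \<subseteq> H 1"
  shows "prod_list us = prod_list vs"
  using assms
proof (induction us arbitrary: vs)
  case (Cons u us)
  then have "u \<in> set vs" by (metis list.set_intros(1) mset_eq_setD)
  then obtain vs1 vs2 where vs: "vs = vs1 @ u # vs2" by (meson split_list)
  have "primitive 1 u" using Cons.prems by (intro primitive_degree_one) simp
  then have "prod_list vs1 * u = u * prod_list vs1" by (rule primitive_central[symmetric])
  then have "prod_list vs = u * prod_list (vs1 @ vs2)" by (simp add: vs flip: mult.assoc)
  moreover have "prod_list us = prod_list (vs1 @ vs2)"
    using Cons.prems by (intro Cons.IH) (auto simp: vs)
  ultimately show ?case by simp
qed simp

text \<open>Here \<open>q\<close> is the product of the points \<open>b i\<close> with
  multiplicities \<open>\<nu> $ i\<close>. A word of the same multidegree has the same product, and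
  any other word has its product in a piece orthogonal to \<open>M \<nu>\<close>.\<close>

lemma reversible_chain_multigraded:
  fixes M :: "nat ^ 'i \<Rightarrow> 'h set"
  assumes a: "a \<ge> 2" and M: "multigrading H \<Delta> M" and C: "multigraded_basis M B C"
    and points: "\<And>i. C (axis i 1) = {b i}"
  shows "reversible_chain (C \<nu>) (hopf_power_matrix H \<Delta> B a (total_degree \<nu>))"
proof -
  define mdeg :: "'i list \<Rightarrow> nat ^ 'i" where "mdeg is = (\<chi> i. count_list is i)" for "is"
  have total_mdeg: "total_degree (mdeg is) = length is" for "is"
    by (simp add: mdeg_def total_degree_def sum_count_set)
  have span_C: "span (C \<mu>) = M \<mu>" and B_C: "B n = (\<Union>\<nu>\<in>{\<nu>. total_degree \<nu> = n}. C \<nu>)" for \<mu> n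
    using C by (auto simp: multigraded_basis_def)
  have C_M: "x \<in> M \<mu>" if "x \<in> C \<mu>" for x \<mu> using that span_C span_base by blast
  have C_B: "C \<mu> \<subseteq> B (total_degree \<mu>)" for \<mu> by (auto simp: B_C)
  have M_sum: "direct_sum {\<nu>. total_degree \<nu> = n} M (H n)"
    and M_mult: "x \<in> M \<mu> \<Longrightarrow> y \<in> M \<mu>' \<Longrightarrow> x * y \<in> M (\<mu> + \<mu>')"
    and M_cop: "x \<in> M \<mu> \<Longrightarrow>
      \<Delta> x \<in> span (\<Union>(\<mu>', \<mu>'')\<in>{(\<mu>', \<mu>''). \<mu>' + \<mu>'' = \<mu>}. tensor_spaces (M \<mu>') (M \<mu>''))"
    for n x y \<mu> \<mu>'
    using M unfolding multigrading_def by blast+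
  have M_orth: "x \<bullet> y = 0" if x: "x \<in> M \<mu>" and y: "y \<in> M \<mu>'" and ne: "\<mu> \<noteq> \<mu>'" for x y \<mu> \<mu>'
  proof (rule inner_eq_0_on_span)
    show "x \<in> span (C \<mu>)" "y \<in> span (C \<mu>')" using x y span_C by auto
    fix u v assume u: "u \<in> C \<mu>" and v: "v \<in> C \<mu>'"
    have uv: "u \<in> basis" "v \<in> basis" using u v C_B by blast+
    have "u \<noteq> v"
    proof
      assume "u = v"
      \<comment> \<open>Directness of \<open>M\<close> is available only within one total degree, so
        the total degrees have to be compared first.\<close>
      have "total_degree \<mu> = total_degree \<mu>'"
        using H_Int[of u "total_degree \<mu>" "total_degree \<mu>'"] u v C_B B_in_H basis_nonzero[OF uv(1)]
        unfolding \<open>u = v\<close> by blast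
      with direct_sum_Int[OF M_sum[of "total_degree \<mu>"] _ _ ne C_M[OF u]] C_M[OF v] \<open>u = v\<close>
      have "u = 0" by simp
      then show False using basis_nonzero[OF uv(1)] by simp
    qed
    then show "u \<bullet> v = 0" by (rule inner_basis[OF uv])
  qed
  have axis_if: "\<exists>i. \<mu> = axis i 1" if "total_degree \<mu> = 1" for \<mu> :: "nat ^ 'i"
  proof -
    have "(\<Sum>i\<in>UNIV. \<mu> $ i) = 1" using that by (simp add: total_degree_def)
    then obtain i where i: "\<mu> $ i = 1" "\<And>j. j \<noteq> i \<Longrightarrow> \<mu> $ j = 0"
      unfolding sum_eq_1_iff[OF finite] by auto
    then show ?thesis by (intro exI[of _ i]) (simp add: vec_eq_iff axis_def)
  qed
  have "total_degree (axis i 1 :: nat ^ 'i) = 1" for i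
    by (simp add: total_degree_def axis_def)
  then have "{\<mu>. total_degree \<mu> = 1} = range (\<lambda>i :: 'i. axis i 1)"
    using axis_if by blast
  then have B1: "B 1 = range b"
    unfolding B_C by (simp only: image_image points) auto
  have b: "b i \<in> H 1" "b i \<noteq> 0" "b i \<in> M (axis i 1)" for i
    using B1 B_in_H[of "b i" 1] basis_nonzero[of "b i"] C_M[of "b i" "axis i 1"] points by auto
  have b_H: "set (map b is) \<subseteq> H 1" for "is" using b(1) by (simp only: set_map) blast
  have prod_M: "prod_list (map b is) \<in> M (mdeg is)" for "is"
  proof (induction "is")
    case Nil
    have "(1::'h) \<in> B 0" using B_0 by simp
    then obtain \<mu> where \<mu>: "1 \<in> C \<mu>" "total_degree \<mu> = 0" unfolding B_C by auto
    then have "\<mu> = 0" by (simp add: total_degree_def vec_eq_iff)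
    moreover have "mdeg [] = 0" by (simp add: mdeg_def vec_eq_iff)
    ultimately show ?case using C_M[OF \<mu>(1)] by simp
  next
    case (Cons i "is")
    have "axis i 1 + mdeg is = mdeg (i # is)" by (simp add: mdeg_def axis_def vec_eq_iff)
    with M_mult[OF b(3)[of i] Cons.IH] show ?case by simp
  qed
  \<comment> \<open>Any ordering of the multiset with \<open>\<nu> $ i\<close> copies of
    \<open>i\<close> will do, by \<open>prod_list_primitives_cong\<close>.\<close>
  obtain "is" where "mset is = (\<Sum>i\<in>UNIV. replicate_mset (\<nu> $ i) i)"
    using ex_mset by blast
  then have is_deg: "mdeg is = \<nu>" by (simp add: mdeg_def vec_eq_iff count_sum flip: count_mset)
  show ?thesis
  proof (rule reversible_chain_hopf_power[OF a C_B])
    show "prod_list (map b is) \<in> span (C \<nu>)" using prod_M[of "is"] is_deg span_C by simp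
    show "prod_list (map b is) \<noteq> 0"
      by (rule prod_primitives_nonzero[OF b_H]) (metis b(2) imageE set_map)
    obtain k where "a = Suc k" using a by (cases a) auto
    show "hopf_power H \<Delta> a x \<in> span (C \<nu>)" if "x \<in> C \<nu>" for x
      unfolding span_C \<open>a = Suc k\<close>
    proof (rule hopf_power_in_graded_piece[of M, OF _ M_mult M_cop C_M[OF that]])
      show "subspace (M \<mu>)" for \<mu> by (simp flip: span_C)
    qed
    fix us x assume us: "set us \<subseteq> B 1" "length us = total_degree \<nu>" and x: "x \<in> C \<nu>"
    then have "set us \<subseteq> range b" using B1 by simp
    then obtain js where js: "us = map b js" by (metis ex_map_conv subset_eq rangeE)
    show "prod_list us = prod_list (map b is) \<or> prod_list us \<bullet> x = 0"
    proof (cases "mdeg js = \<nu>")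
      case True
      then have "mset js = mset is"
        using is_deg by (auto simp: multiset_eq_iff mdeg_def vec_eq_iff count_mset)
      then have "mset (map b js) = mset (map b is)" by simp
      then have "prod_list (map b js) = prod_list (map b is)"
        by (rule prod_list_primitives_cong[OF _ b_H])
      then show ?thesis using js by simp
    next
      case False
      then show ?thesis using M_orth[OF prod_M[of js] C_M[OF x]] js by simp
    qed
  qed
qed

end

theorem theorem4p6p3:
  fixes H :: "nat \<Rightarrow> 'h::{real_algebra_1, real_inner} set"
    and \<Delta> :: "'h \<Rightarrow> 'h tensor"
    and B :: "nat \<Rightarrow> 'h set"
    and a :: nat
  assumes "graded_connected_hopf_algebra H \<Delta>"
    and "\<forall>n. \<exists>S. finite S \<and> span S = H n"
    and "\<forall>w z x. (w * z) \<bullet> x = tensor_inner (w \<otimes> z) (\<Delta> x)"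
    and "state_space_basis H \<Delta> B"
    and "pairwise orthogonal (\<Union>n. B n)"
    and "\<forall>n>1. \<forall>y\<in>B n. \<exists>i>0. \<exists>j>0. \<exists>w\<in>B i. \<exists>z\<in>B j. product_coeff B [w, z] y \<noteq> 0"
    and "a \<ge> 2"
  shows "((\<exists>b. B 1 = {b}) \<longrightarrow>
            (\<forall>n. reversible_chain (B n) (hopf_power_matrix H \<Delta> B a n))) \<and>
         (\<forall>(M :: nat ^ 'i \<Rightarrow> 'h set) C.
            multigrading H \<Delta> M \<and> multigraded_basis M B C \<and> (\<forall>i. \<exists>b. C (axis i 1) = {b}) \<longrightarrow>
            (\<forall>\<nu>. reversible_chain (C \<nu>) (hopf_power_matrix H \<Delta> B a (total_degree \<nu>))))"
proof -
  interpret orthogonal_state_space H \<Delta> B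
    by (intro orthogonal_state_space.intro orthogonal_state_space_axioms.intro assms(1,4,5)
        assms(2,3,6)[rule_format])
  have "reversible_chain (C \<nu>) (hopf_power_matrix H \<Delta> B a (total_degree \<nu>))"
    if M: "multigrading H \<Delta> M" and C: "multigraded_basis M B C"
      and points: "\<forall>i. \<exists>b. C (axis i 1) = {b}"
    for M :: "nat ^ 'i \<Rightarrow> 'h set" and C \<nu>
  proof -
    obtain b where "\<And>i. C (axis i 1) = {b i}" using points by metis
    then show ?thesis by (rule reversible_chain_multigraded[OF assms(7) M C])
  qed
  then show ?thesis using reversible_chain_one_point[OF assms(7)] by blast
qed

end
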